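(* Suppose $\gamma_n<0$ for all $n$, $E\varepsilon_0^2=1$, $E|\varepsilon_0|^{4+\delta}<\infty$ for some $\delta>0$, and, as $n\to\infty$, $$n\alpha_n\to\infty,\quad n^{1/2}\gamma_n\to0,\quad n|\gamma_n|\to\infty,\quad \alpha_n n^{1/2}\log\log n\to0,\quad \frac{|\gamma_n|^{3/2}}{\alpha_n}\to0.$$ Let $N\ge1$ be a fixed integer and $0<t_1<t_2<\cdots<t_N\le1$. Then the random variables $$\frac{\sqrt{2|\gamma|^3}}{\alpha}\,\frac{1}{\sqrt{E\xi_0^2}}\Big[\frac{\sigma_{[nt_m]}^2}{\omega}-\sum_{1\le j\le[nt_m]-1}e^{j\gamma}\Big],\qquad 1\le m\le N,$$ are asymptotically independent standard normal; that is, as $n\to\infty$ they converge jointly in distribution to a vector of $N$ independent standard normal random variables.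
   Context: Let $\varepsilon_0,\varepsilon_1,\varepsilon_2,\dots$ be independent identically distributed real random variables (not necessarily of mean zero) such that the distribution of $\varepsilon_0^2$ is nondegenerate. Let $\omega>0$ be a constant. For each $n\ge1$ let $\alpha=\alpha_n\ge0$ and $\beta=\beta_n\ge0$ be real numbers with $\alpha_n\to0$ and $\beta_n\to1$ as $n\to\infty$. Given an initial value $\sigma_0$ (a fixed real number not depending on $n$) and $y_0=\sigma_0\varepsilon_0$, define for each $n$ the sequences $\sigma_k\ge 0$ and $y_k$, $1\le k\le n$ (which depend on $n$ through $\alpha_n,\beta_n$), by $y_k=\sigma_k\varepsilon_k$ and $\sigma_k^2=\omega+\alpha y_{k-1}^2+\beta\sigma_{k-1}^2$. Put $\gamma=\gamma_n=\alpha_n+\beta_n-1$ and $\xi_j=\varepsilon_j^2-1$. $[x]$ denotes the integer part of $x$. *)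

theory Defs
  imports "HOL-Probability.Probability"
begin

text \<open>
  One path of the GARCH(1,1) recursion with parameters \<open>\<omega>\<close>, \<open>\<alpha>\<close>, \<open>\<beta>\<close>, started at \<open>\<sigma>\<^sub>0\<close> and driven
  by the noise path \<open>e\<close>. The initial value may be negative; all later values are taken to be
  nonnegative square roots.
\<close>

primrec garch_sigma ::
  "real \<Rightarrow> real \<Rightarrow> real \<Rightarrow> real \<Rightarrow> (nat \<Rightarrow> real) \<Rightarrow> nat \<Rightarrow> real" where
  "garch_sigma \<omega> \<alpha> \<beta> \<sigma>\<^sub>0 e 0 = \<sigma>\<^sub>0"
| "garch_sigma \<omega> \<alpha> \<beta> \<sigma>\<^sub>0 e (Suc k) =
     sqrt (\<omega> + \<alpha> * (garch_sigma \<omega> \<alpha> \<beta> \<sigma>\<^sub>0 e k * e k)\<^sup>2 + \<beta> * (garch_sigma \<omega> \<alpha> \<beta> \<sigma>\<^sub>0 e k)\<^sup>2)"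

definition garch_y ::
  "real \<Rightarrow> real \<Rightarrow> real \<Rightarrow> real \<Rightarrow> (nat \<Rightarrow> real) \<Rightarrow> nat \<Rightarrow> real" where
  "garch_y \<omega> \<alpha> \<beta> \<sigma>\<^sub>0 e k = garch_sigma \<omega> \<alpha> \<beta> \<sigma>\<^sub>0 e k * e k"

lemma garch_sigma_Suc_nonneg:
  assumes "\<omega> \<ge> 0" "\<alpha> \<ge> 0" "\<beta> \<ge> 0"
  shows "garch_sigma \<omega> \<alpha> \<beta> \<sigma>\<^sub>0 e (Suc k) \<ge> 0"
  using assms by simp

lemma garch_sigma_Suc_squared:
  assumes "\<omega> \<ge> 0" "\<alpha> \<ge> 0" "\<beta> \<ge> 0"
  shows "(garch_sigma \<omega> \<alpha> \<beta> \<sigma>\<^sub>0 e (Suc k))\<^sup>2 =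
    \<omega> + \<alpha> * (garch_y \<omega> \<alpha> \<beta> \<sigma>\<^sub>0 e k)\<^sup>2 + \<beta> * (garch_sigma \<omega> \<alpha> \<beta> \<sigma>\<^sub>0 e k)\<^sup>2"
  using assms by (simp add: garch_y_def)

text \<open>
  Weak convergence of Borel measures, tested against bounded continuous functions. The library's
  \<open>weak_conv_m\<close> covers only measures on the real line.
\<close>

definition converges_weakly ::
  "(nat \<Rightarrow> 'b::topological_space measure) \<Rightarrow> 'b measure \<Rightarrow> bool" where
  "converges_weakly \<mu> \<nu> \<longleftrightarrow>
     (\<forall>f :: 'b \<Rightarrow> real. continuous_on UNIV f \<longrightarrow> bounded (range f) \<longrightarrow>
        (\<lambda>n. \<integral>x. f x \<partial>\<mu> n) \<longlonglongrightarrow> (\<integral>x. f x \<partial>\<nu>))"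

definition std_normal_vec :: "(real ^ 'n) measure" where
  "std_normal_vec = distr (\<Pi>\<^sub>M i\<in>(UNIV :: 'n set). std_normal_distribution) borel vec_lambda"

lemma measurable_vec_lambda_PiM:
  "vec_lambda \<in> (\<Pi>\<^sub>M i\<in>(UNIV :: 'n::finite set). (borel :: real measure)) \<rightarrow>\<^sub>M borel"
proof (rule borel_measurable_euclidean_space[THEN iffD2], intro ballI)
  fix b :: "real ^ 'n" assume "b \<in> Basis"
  then obtain i where b: "b = axis i 1"
    by (auto simp: Basis_vec_def)
  have "(\<lambda>x. vec_lambda x \<bullet> b) = (\<lambda>x. x i)"
    by (simp add: b inner_axis)
  then show "(\<lambda>x. vec_lambda x \<bullet> b) \<in> borel_measurable (\<Pi>\<^sub>M i\<in>(UNIV :: 'n set). (borel :: real measure))"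
    by simp
qed

lemma (in prob_space) distr_indep_std_normal:
  fixes X :: "'n::finite \<Rightarrow> 'a \<Rightarrow> real"
  assumes indep: "indep_vars (\<lambda>_. borel) X UNIV"
    and normal: "\<And>i. distr M borel (X i) = std_normal_distribution"
  shows "distr M borel (\<lambda>x. \<chi> i. X i x) = std_normal_vec"
proof -
  have X [measurable]: "X i \<in> borel_measurable M" for i
    using indep by (auto simp: indep_vars_def)
  have meas: "(\<lambda>x. \<lambda>i\<in>UNIV. X i x) \<in> M \<rightarrow>\<^sub>M (\<Pi>\<^sub>M i\<in>UNIV. borel)"
    by (rule measurable_restrict) simp
  have "distr M (\<Pi>\<^sub>M i\<in>UNIV. borel) (\<lambda>x. \<lambda>i\<in>UNIV. X i x) = (\<Pi>\<^sub>M i\<in>UNIV. std_normal_distribution)"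
    using indep by (subst (asm) indep_vars_iff_distr_eq_PiM) (auto simp: normal)
  then have "std_normal_vec =
      distr (distr M (\<Pi>\<^sub>M i\<in>(UNIV :: 'n set). borel) (\<lambda>x. \<lambda>i\<in>UNIV. X i x)) borel vec_lambda"
    by (simp add: std_normal_vec_def)
  also have "\<dots> = distr M borel (\<lambda>x. \<chi> i. X i x)"
    by (subst distr_distr) (use meas in \<open>auto simp: measurable_vec_lambda_PiM o_def restrict_UNIV\<close>)
  finally show ?thesis ..
qed

end

theory Submission
  imports Defs
begin

text \<open>
  Put \<open>h = -\<gamma>\<close>. The relative deviation \<open>u = h \<sigma>\<^sup>2 / \<omega> - 1\<close> of the volatility from its equilibrium obeys
  \<open>u\<^bsub>k+1\<^esub> = (1 - h) u\<^sub>k + \<alpha> (1 + u\<^sub>k) \<xi>\<^sub>k\<close>. Dropping \<open>u\<^sub>k \<xi>\<^sub>k\<close> leaves the weighted sum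
  \<open>\<alpha> \<Sum> (1 - h)\<^bsup>k-1-j\<^esup> \<xi>\<^sub>j\<close>; since \<open>\<xi>\<^sub>k\<close> is centered and independent of the past, second moments give
  \<open>E u\<^sub>k\<^sup>2 = O(\<alpha>\<^sup>2 / h)\<close> up to a geometrically decaying term, and the error of the linearisation is negligible
  because \<open>\<alpha>\<^sup>2 / h \<rightarrow> 0\<close>. The centering differs from the mean by \<open>O(1)\<close>, which the factor \<open>h\<^bsup>3/2\<^esup> / \<alpha>\<close> kills.
  Since \<open>n h \<rightarrow> \<infinity>\<close>, the sum at time \<open>t\<^sub>m\<close> may be restricted to the indices after time \<open>t\<^bsub>m-1\<^esub>\<close>, which makes the
  components independent; each is asymptotically normal by comparison of characteristic functions.
\<close>

section \<open>Elementary bounds\<close>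

lemma exp_minus_le_quadratic:
  fixes y :: real
  assumes "0 \<le> y"
  shows "exp (- y) \<le> 1 - y + y\<^sup>2 / 2"
proof -
  have pos: "0 < 1 + y + y\<^sup>2 / 2"
    using assms by (intro add_pos_nonneg) auto
  have "exp (- y) = inverse (exp y)"
    by (rule exp_minus)
  also have "\<dots> \<le> inverse (1 + y + y\<^sup>2 / 2)"
    using exp_lower_Taylor_quadratic[OF assms] pos by (intro le_imp_inverse_le)
  also have "\<dots> \<le> 1 - y + y\<^sup>2 / 2"
  proof -
    have "(1 - y + y\<^sup>2 / 2) * (1 + y + y\<^sup>2 / 2) = 1 + (y\<^sup>2)\<^sup>2 / 4"
      by (simp add: algebra_simps power2_eq_square)
    then have "1 \<le> (1 - y + y\<^sup>2 / 2) * (1 + y + y\<^sup>2 / 2)"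
      by simp
    then show ?thesis
      using pos by (simp add: inverse_eq_divide pos_divide_le_eq)
  qed
  finally show ?thesis .
qed

lemma sum_power_rev_ivl:
  fixes g :: "'a::comm_semiring_1"
  shows "(\<Sum>j\<in>{p..<k}. g ^ (k - 1 - j)) = (\<Sum>i<k - p. g ^ i)"
  by (rule sum.reindex_bij_witness[of _ "\<lambda>i. k - 1 - i" "\<lambda>j. k - 1 - j"]) auto

lemma one_minus_power_le_exp:
  fixes z :: real
  assumes "z \<le> 1"
  shows "(1 - z) ^ k \<le> exp (- (z * k))"
proof -
  have "(1 - z) ^ k \<le> exp (- z) ^ k"
    using assms exp_ge_add_one_self[of "-z"] by (intro power_mono) auto
  then show ?thesis
    by (simp add: exp_of_nat_mult[symmetric] mult.commute)
qed

lemma power2_sum3_le: "(x + y + z)\<^sup>2 \<le> 3 * (x\<^sup>2 + y\<^sup>2 + z\<^sup>2)" for x y z :: real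
proof -
  have "3 * (x\<^sup>2 + y\<^sup>2 + z\<^sup>2) - (x + y + z)\<^sup>2 = (x - y)\<^sup>2 + (y - z)\<^sup>2 + (x - z)\<^sup>2"
    by (simp add: power2_eq_square algebra_simps)
  moreover have "0 \<le> (x - y)\<^sup>2 + (y - z)\<^sup>2 + (x - z)\<^sup>2"
    by simp
  ultimately show ?thesis by linarith
qed

lemma real_nat_floor_diff_ge:
  fixes x y :: real
  assumes "0 \<le> x" "x \<le> y"
  shows "y - x - 1 \<le> real (nat \<lfloor>y\<rfloor> - nat \<lfloor>x\<rfloor>)"
proof -
  have "\<lfloor>x\<rfloor> \<le> \<lfloor>y\<rfloor>" "0 \<le> \<lfloor>x\<rfloor>" using assms by (auto intro: floor_mono)
  then have "real (nat \<lfloor>y\<rfloor> - nat \<lfloor>x\<rfloor>) = of_int \<lfloor>y\<rfloor> - of_int \<lfloor>x\<rfloor>"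
    by (simp add: nat_diff_distrib[symmetric] of_nat_nat)
  then show ?thesis by linarith
qed

text \<open>Both geometric sums solve a recursion with the same forcing term, so their difference \<open>D\<close> obeys
  \<open>D\<^bsub>k+1\<^esub> \<le> (1 - h) D\<^bsub>k\<^esub> + h\<close>.\<close>

lemma exp_geometric_sum_diff:
  fixes h :: real
  assumes h: "0 < h" "h \<le> 1"
  shows "0 \<le> (\<Sum>j<k. exp (- h) ^ j) - (\<Sum>j<k. (1 - h) ^ j)"
    and "(\<Sum>j<k. exp (- h) ^ j) - (\<Sum>j<k. (1 - h) ^ j) \<le> 1"
proof -
  let ?y = "exp (- h)"
  define D where "D k = (\<Sum>j<k. ?y ^ j) - (\<Sum>j<k. (1 - h) ^ j)" for k
  have y1: "1 - h \<le> ?y"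
    using exp_ge_add_one_self[of "-h"] by simp
  have y2: "?y \<le> 1 - h + h\<^sup>2 / 2"
    using h by (intro exp_minus_le_quadratic) simp
  moreover have "h\<^sup>2 \<le> h"
    using h by (simp add: power2_eq_square mult_left_le)
  ultimately have y3: "h / 2 \<le> 1 - ?y"
    by simp
  have S0: "(\<Sum>j<Suc k. z ^ j) = 1 + z * (\<Sum>j<k. z ^ j)" for z :: real and k
    by (simp add: sum.lessThan_Suc_shift sum_distrib_left del: sum.lessThan_Suc)
  have S: "(\<Sum>j<k. ?y ^ j) \<le> 2 / h" for k
  proof -
    have "(\<Sum>j<k. ?y ^ j) \<le> 1 / (1 - ?y)"
      using h by (simp add: sum_gp_strict divide_right_mono)
    also have "\<dots> \<le> 2 / h"
      using frac_le[of 1 1 "h / 2" "1 - ?y"] y3 h by simp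
    finally show ?thesis .
  qed
  have "0 \<le> D k \<and> D k \<le> 1" for k
  proof (induction k)
    case (Suc k)
    have D: "D (Suc k) = (1 - h) * D k + (?y - (1 - h)) * (\<Sum>j<k. ?y ^ j)"
      unfolding D_def S0 by (simp add: algebra_simps)
    have "(?y - (1 - h)) * (\<Sum>j<k. ?y ^ j) \<le> (h\<^sup>2 / 2) * (2 / h)"
      using y2 S by (intro mult_mono sum_nonneg) auto
    also have "\<dots> = h" using h by (simp add: power2_eq_square)
    finally have "(?y - (1 - h)) * (\<Sum>j<k. ?y ^ j) \<le> h" .
    moreover have "(1 - h) * D k \<le> (1 - h) * 1"
      using Suc h by (intro mult_left_mono) auto
    moreover have "0 \<le> (?y - (1 - h)) * (\<Sum>j<k. ?y ^ j)"
      using y1 by (intro mult_nonneg_nonneg sum_nonneg) auto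
    moreover have "0 \<le> (1 - h) * D k" using Suc h by simp
    ultimately show ?case unfolding D by simp
  qed (simp add: D_def)
  then show "0 \<le> (\<Sum>j<k. exp (- h) ^ j) - (\<Sum>j<k. (1 - h) ^ j)"
    and "(\<Sum>j<k. exp (- h) ^ j) - (\<Sum>j<k. (1 - h) ^ j) \<le> 1"
    by (auto simp: D_def)
qed

lemma centering_bound:
  fixes h x\<^sub>0 :: real
  assumes h: "0 < h" "h \<le> 1" and x0: "0 \<le> x\<^sub>0"
  shows "\<bar>(1 + (1 - h) ^ k * (h * x\<^sub>0 - 1)) / h - (\<Sum>j = 1..k - 1. exp (real j * - h))\<bar> \<le> 1 + x\<^sub>0"
proof (cases k)
  case 0
  then show ?thesis using assms by simp
next
  case (Suc l)
  let ?D = "(\<Sum>j<k. exp (- h) ^ j) - (\<Sum>j<k. (1 - h) ^ j)"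
  have "(\<Sum>j<k. exp (- h) ^ j) = 1 + (\<Sum>j = 1..k - 1. exp (real j * - h))"
    unfolding Suc lessThan_Suc_atMost atMost_atLeast0
    by (simp add: sum.atLeast_Suc_atMost exp_of_nat_mult[symmetric])
  moreover have "(1 + (1 - h) ^ k * (h * x\<^sub>0 - 1)) / h = (\<Sum>j<k. (1 - h) ^ j) + (1 - h) ^ k * x\<^sub>0"
    using h by (simp add: sum_gp_strict field_simps)
  ultimately have "(1 + (1 - h) ^ k * (h * x\<^sub>0 - 1)) / h - (\<Sum>j = 1..k - 1. exp (real j * - h)) =
      1 - ?D + (1 - h) ^ k * x\<^sub>0"
    by simp
  moreover have "0 \<le> ?D" "?D \<le> 1"
    using exp_geometric_sum_diff[OF h] by auto
  moreover have "(1 - h) ^ k * x\<^sub>0 \<le> 1 * x\<^sub>0" "0 \<le> (1 - h) ^ k * x\<^sub>0"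
    using h x0 by (intro mult_right_mono power_le_one, auto)
  ultimately show ?thesis by linarith
qed

section \<open>Weak convergence of random vectors\<close>

lemma borel_measurable_vec_lambda:
  fixes X :: "'n::finite \<Rightarrow> 'a \<Rightarrow> real"
  assumes "\<And>i. X i \<in> borel_measurable M"
  shows "(\<lambda>x. \<chi> i. X i x) \<in> borel_measurable M"
proof -
  have "(\<lambda>x. \<lambda>i\<in>UNIV. X i x) \<in> M \<rightarrow>\<^sub>M PiM UNIV (\<lambda>_. borel)"
    using assms by (intro measurable_restrict) auto
  from measurable_compose[OF this measurable_vec_lambda_PiM] show ?thesis
    by (simp add: restrict_UNIV)
qed

lemma distr_PiM_componentwise:
  assumes "finite I" and "\<And>i. i \<in> I \<Longrightarrow> prob_space (M i)"
    and f [measurable]: "\<And>i. i \<in> I \<Longrightarrow> f i \<in> M i \<rightarrow>\<^sub>M N i"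
  shows "distr (PiM I M) (PiM I N) (\<lambda>x. \<lambda>i\<in>I. f i (x i)) = PiM I (\<lambda>i. distr (M i) (N i) (f i))"
    (is "?L = ?R")
proof (rule measure_eqI_PiM_finite[symmetric])
  have meas: "(\<lambda>x. \<lambda>i\<in>I. f i (x i)) \<in> PiM I M \<rightarrow>\<^sub>M PiM I N"
    by (rule measurable_restrict) measurable
  define M' where "M' i = (if i \<in> I then M i else return (count_space UNIV) undefined)" for i
  interpret M': product_prob_space M' I
    unfolding product_prob_space_def product_prob_space_axioms_def product_sigma_finite_def
    using assms by (auto simp: M'_def intro!: prob_space_imp_sigma_finite prob_space_return)
  have M': "PiM I M = PiM I M'"
    by (rule PiM_cong) (auto simp: M'_def)
  define D where "D i = (if i \<in> I then distr (M i) (N i) (f i) else return (count_space UNIV) undefined)" for i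
  interpret D: product_prob_space D I
    unfolding product_prob_space_def product_prob_space_axioms_def product_sigma_finite_def
    using assms by (auto simp: D_def intro!: prob_space_imp_sigma_finite prob_space_return prob_space.prob_space_distr)
  have D: "?R = PiM I D"
    by (rule PiM_cong) (auto simp: D_def)
  show "finite I" by fact
  show "sets ?R = PiM I N" by (auto intro!: sets_PiM_cong)
  show "sets ?L = PiM I N" by simp
  fix A assume A: "\<And>i. i \<in> I \<Longrightarrow> A i \<in> sets (N i)"
  have "emeasure ?R (Pi\<^sub>E I A) = (\<Prod>i\<in>I. emeasure (distr (M i) (N i) (f i)) (A i))"
    unfolding D using A \<open>finite I\<close> by (subst D.emeasure_PiM) (auto simp: D_def)
  also have "\<dots> = (\<Prod>i\<in>I. emeasure (M' i) (f i -` A i \<inter> space (M i)))"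
    using A by (intro prod.cong refl) (simp add: emeasure_distr f M'_def)
  also have "\<dots> = emeasure (PiM I M) (\<Pi>\<^sub>E i\<in>I. f i -` A i \<inter> space (M i))"
    unfolding M' using A \<open>finite I\<close> f
    by (subst M'.emeasure_PiM) (auto simp: M'_def intro!: measurable_sets)
  also have "(\<Pi>\<^sub>E i\<in>I. f i -` A i \<inter> space (M i)) = (\<lambda>x. \<lambda>i\<in>I. f i (x i)) -` Pi\<^sub>E I A \<inter> space (PiM I M)"
    by (auto simp: space_PiM PiE_iff extensional_def)
  also have "emeasure (PiM I M) \<dots> = emeasure ?L (Pi\<^sub>E I A)"
    using A \<open>finite I\<close> by (subst emeasure_distr[OF meas]) (auto intro!: sets_PiM_I_finite)
  finally show "emeasure ?R (Pi\<^sub>E I A) = emeasure ?L (Pi\<^sub>E I A)" .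
next
  show "range (\<lambda>_::nat. Pi\<^sub>E I (\<lambda>i. space (N i))) \<subseteq> prod_algebra I N"
    using assms(1) by (auto intro!: prod_algebraI_finite)
  show "\<Union> (range (\<lambda>_::nat. Pi\<^sub>E I (\<lambda>i. space (N i)))) = space (PiM I N)"
    by (auto simp: space_PiM)
  interpret R: prob_space ?R
    using assms by (intro prob_space_PiM prob_space.prob_space_distr) auto
  show "emeasure ?R (Pi\<^sub>E I (\<lambda>i. space (N i))) \<noteq> \<infinity>" for n :: nat
    by simp
qed

text \<open>Skorohod's theorem in each coordinate reduces the claim to pointwise convergence on the
  product of the coupling spaces.\<close>

lemma converges_weakly_PiM:
  fixes \<mu> :: "nat \<Rightarrow> 'n::finite \<Rightarrow> real measure" and \<nu> :: "'n \<Rightarrow> real measure"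
  assumes \<mu>: "\<And>n i. real_distribution (\<mu> n i)" and \<nu>: "\<And>i. real_distribution (\<nu> i)"
    and conv: "\<And>i. weak_conv_m (\<lambda>n. \<mu> n i) (\<nu> i)"
  shows "converges_weakly (\<lambda>n. distr (PiM UNIV (\<mu> n)) borel vec_lambda)
    (distr (PiM UNIV \<nu>) borel vec_lambda)"
  unfolding converges_weakly_def
proof (intro allI impI)
  fix f :: "real ^ 'n \<Rightarrow> real"
  assume f: "continuous_on UNIV f" and "bounded (range f)"
  then obtain B where B: "\<And>x. norm (f x) \<le> B"
    by (auto simp: bounded_iff)
  have [measurable]: "f \<in> borel_measurable borel"
    using f by (rule borel_measurable_continuous_onI)
  note [measurable] = measurable_vec_lambda_PiM
  have "\<forall>i. \<exists>(\<Omega> :: real measure) (Z :: nat \<Rightarrow> real \<Rightarrow> real) (Y :: real \<Rightarrow> real).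
      prob_space \<Omega> \<and> (\<forall>n. Z n \<in> borel_measurable \<Omega>) \<and> (\<forall>n. distr \<Omega> borel (Z n) = \<mu> n i) \<and>
      Y \<in> measurable \<Omega> lborel \<and> distr \<Omega> borel Y = \<nu> i \<and>
      (\<forall>x\<in>space \<Omega>. (\<lambda>n. Z n x) \<longlonglongrightarrow> Y x)"
    using Skorohod[OF \<mu> \<nu> conv] by blast
  then obtain \<Omega> :: "'n \<Rightarrow> real measure" and Z Y where
    \<Omega>: "\<And>i. prob_space (\<Omega> i)" and
    Z [measurable]: "\<And>i n. Z i n \<in> borel_measurable (\<Omega> i)" and
    dZ: "\<And>i n. distr (\<Omega> i) borel (Z i n) = \<mu> n i" and
    Y: "\<And>i. Y i \<in> measurable (\<Omega> i) lborel" and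
    dY: "\<And>i. distr (\<Omega> i) borel (Y i) = \<nu> i" and
    ZY: "\<And>i x. x \<in> space (\<Omega> i) \<Longrightarrow> (\<lambda>n. Z i n x) \<longlonglongrightarrow> Y i x"
    by metis
  have [measurable]: "Y i \<in> borel_measurable (\<Omega> i)" for i
    using Y[of i] by simp
  interpret prob_space "PiM UNIV \<Omega>"
    by (rule prob_space_PiM) (rule \<Omega>)
  have meas: "(\<lambda>x. \<chi> i. W i (x i)) \<in> borel_measurable (PiM UNIV \<Omega>)"
    if [measurable]: "\<And>i. W i \<in> borel_measurable (\<Omega> i)" for W :: "'n \<Rightarrow> real \<Rightarrow> real"
    by (rule borel_measurable_vec_lambda) measurable
  have fm: "(\<lambda>x. f (\<chi> i. W i (x i))) \<in> borel_measurable (PiM UNIV \<Omega>)"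
    if "\<And>i. W i \<in> borel_measurable (\<Omega> i)" for W :: "'n \<Rightarrow> real \<Rightarrow> real"
    using meas[OF that] by measurable
  have *: "(\<integral>x. f x \<partial>distr (PiM UNIV \<rho>) borel vec_lambda) = (\<integral>x. f (\<chi> i. W i (x i)) \<partial>PiM UNIV \<Omega>)"
    if [measurable]: "\<And>i. W i \<in> borel_measurable (\<Omega> i)" and "\<And>i. distr (\<Omega> i) borel (W i) = \<rho> i"
    for W \<rho>
  proof -
    have "PiM UNIV \<rho> = PiM UNIV (\<lambda>i. distr (\<Omega> i) borel (W i))"
      using that by simp
    also have "\<dots> = distr (PiM UNIV \<Omega>) (PiM UNIV (\<lambda>_. borel)) (\<lambda>x. \<lambda>i\<in>UNIV. W i (x i))"
      using \<Omega> by (intro distr_PiM_componentwise[symmetric]) auto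
    finally have "distr (PiM UNIV \<rho>) borel vec_lambda =
        distr (distr (PiM UNIV \<Omega>) (PiM UNIV (\<lambda>_. borel)) (\<lambda>x. \<lambda>i\<in>UNIV. W i (x i))) borel vec_lambda"
      by simp
    also have "\<dots> = distr (PiM UNIV \<Omega>) borel (\<lambda>x. \<chi> i. W i (x i))"
      by (subst distr_distr) (auto simp: o_def restrict_UNIV intro!: measurable_PiM_single')
    finally have eq: "distr (PiM UNIV \<rho>) borel vec_lambda = distr (PiM UNIV \<Omega>) borel (\<lambda>x. \<chi> i. W i (x i))" .
    show ?thesis
      unfolding eq by (rule integral_distr[OF meas[OF that(1)]]) fact
  qed
  have "(\<lambda>n. \<integral>x. f (\<chi> i. Z i n (x i)) \<partial>PiM UNIV \<Omega>) \<longlonglongrightarrow> (\<integral>x. f (\<chi> i. Y i (x i)) \<partial>PiM UNIV \<Omega>)"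
  proof (rule integral_dominated_convergence[where w = "\<lambda>_. B"])
    show "AE x in PiM UNIV \<Omega>. (\<lambda>n. f (\<chi> i. Z i n (x i))) \<longlonglongrightarrow> f (\<chi> i. Y i (x i))"
    proof (rule AE_I2)
      fix x assume x: "x \<in> space (PiM UNIV \<Omega>)"
      have "(\<lambda>n. \<chi> i. Z i n (x i)) \<longlonglongrightarrow> (\<chi> i. Y i (x i))"
        using x by (intro tendsto_vec_lambda ZY) (auto simp: space_PiM)
      then show "(\<lambda>n. f (\<chi> i. Z i n (x i))) \<longlonglongrightarrow> f (\<chi> i. Y i (x i))"
        by (rule isCont_tendsto_compose[rotated]) (use f in \<open>simp add: continuous_on_eq_continuous_at\<close>)
    qed
  qed (use B fm in auto)
  then show "(\<lambda>n. \<integral>x. f x \<partial>distr (PiM UNIV (\<mu> n)) borel vec_lambda) \<longlonglongrightarrow>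
      (\<integral>x. f x \<partial>distr (PiM UNIV \<nu>) borel vec_lambda)"
    using *[OF Z dZ] *[of Y \<nu>] dY by simp
qed

lemma (in prob_space) converges_weakly_perturb:
  fixes X U :: "nat \<Rightarrow> 'a \<Rightarrow> 'b::euclidean_space" and K :: real
  assumes [measurable]: "\<And>n. X n \<in> borel_measurable M" "\<And>n. U n \<in> borel_measurable M"
    and conv: "converges_weakly (\<lambda>n. distr M borel (U n)) \<nu>"
    and U: "\<forall>\<^sub>F n in sequentially. integrable M (\<lambda>x. (norm (U n x))\<^sup>2) \<and> (\<integral>x. (norm (U n x))\<^sup>2 \<partial>M) \<le> K"
    and diff: "\<forall>\<^sub>F n in sequentially. integrable M (\<lambda>x. (norm (X n x - U n x))\<^sup>2)"
    and lim: "(\<lambda>n. \<integral>x. (norm (X n x - U n x))\<^sup>2 \<partial>M) \<longlonglongrightarrow> 0"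
  shows "converges_weakly (\<lambda>n. distr M borel (X n)) \<nu>"
  unfolding converges_weakly_def
proof (intro allI impI)
  fix f :: "'b \<Rightarrow> real"
  assume f: "continuous_on UNIV f" and bd: "bounded (range f)"
  then obtain B where B: "\<And>x. \<bar>f x\<bar> \<le> B"
    by (auto simp: bounded_iff)
  have [measurable]: "f \<in> borel_measurable borel"
    using f by (rule borel_measurable_continuous_onI)
  have B0: "B \<ge> 0"
    using B[of 0] by linarith
  define K' where "K' = max K 1"
  have int: "integrable M (\<lambda>x. f (V x))" if [measurable]: "V \<in> borel_measurable M" for V
    using B by (intro integrable_const_bound[where B=B]) auto
  have "(\<lambda>n. (\<integral>x. f (X n x) \<partial>M) - (\<integral>x. f (U n x) \<partial>M)) \<longlonglongrightarrow> 0"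
  proof (rule LIMSEQ_I)
    fix e :: real assume e: "e > 0"
    define R where "R = sqrt (8 * (B + 1) * K' / e)"
    have K': "K' > 0"
      by (simp add: K'_def)
    have "R\<^sup>2 = 8 * (B + 1) * K' / e"
      using e B0 K' unfolding R_def by (intro real_sqrt_pow2) simp
    then have "e / 4 * R\<^sup>2 = 2 * (B + 1) * K'"
      using e by simp
    then have RK: "2 * B * K' \<le> e / 4 * R\<^sup>2"
      using K' by (simp add: distrib_right)
    have R: "R > 0"
      using e B0 K' unfolding R_def by simp
    then have R2: "2 * B * K' / R\<^sup>2 \<le> e / 4"
      using RK by (subst pos_divide_le_eq) auto
    have "uniformly_continuous_on (cball 0 (R + 1)) f"
      using f by (intro compact_uniformly_continuous) (auto intro: continuous_on_subset)
    then obtain d where d: "d > 0" and fd: "\<And>x y. x \<in> cball 0 (R + 1) \<Longrightarrow> y \<in> cball 0 (R + 1) \<Longrightarrow>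
        dist y x < d \<Longrightarrow> dist (f y) (f x) < e / 4"
      unfolding uniformly_continuous_on_def using e by (metis divide_pos_pos zero_less_numeral)
    define d' where "d' = min d 1"
    have d': "d' > 0" "d' \<le> d" "d' \<le> 1" using d by (auto simp: d'_def)
    have pt: "\<bar>f x - f y\<bar> \<le> e / 4 + 2 * B * (norm y)\<^sup>2 / R\<^sup>2 + 2 * B * (norm (x - y))\<^sup>2 / d'\<^sup>2" for x y
    proof -
      have nn: "0 \<le> 2 * B * (norm y)\<^sup>2 / R\<^sup>2" "0 \<le> 2 * B * (norm (x - y))\<^sup>2 / d'\<^sup>2"
        using B0 by auto
      have *: "z \<le> e / 4 + p + q" if "0 \<le> p" "0 \<le> q" "z \<le> p \<or> z \<le> q \<or> z \<le> e / 4" for z p q :: real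
        using that e by auto
      have fB: "\<bar>f x - f y\<bar> \<le> 2 * B"
        using B[of x] B[of y] by linarith
      consider "norm y > R" | "norm (x - y) \<ge> d'" | "norm y \<le> R" "norm (x - y) < d'"
        by linarith
      then show ?thesis
      proof cases
        case 1
        then have "1 \<le> (norm y)\<^sup>2 / R\<^sup>2"
          using R by (simp add: power_mono)
        then have "2 * B * 1 \<le> 2 * B * ((norm y)\<^sup>2 / R\<^sup>2)"
          using B0 by (intro mult_left_mono) auto
        then have "2 * B \<le> 2 * B * (norm y)\<^sup>2 / R\<^sup>2"
          by simp
        with fB show ?thesis by (intro *[OF nn]) (meson order_trans)
      next
        case 2
        then have "1 \<le> (norm (x - y))\<^sup>2 / d'\<^sup>2"
          using d' by (simp add: power_mono)
        then have "2 * B * 1 \<le> 2 * B * ((norm (x - y))\<^sup>2 / d'\<^sup>2)"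
          using B0 by (intro mult_left_mono) auto
        then have "2 * B \<le> 2 * B * (norm (x - y))\<^sup>2 / d'\<^sup>2"
          by simp
        with fB show ?thesis by (intro *[OF nn]) (meson order_trans)
      next
        case 3
        have "norm x \<le> R + 1"
          using 3 d' norm_triangle_sub[of x y] by linarith
        then have "dist (f x) (f y) < e / 4"
          using 3 d' by (intro fd) (auto simp: dist_norm)
        then show ?thesis by (intro *[OF nn]) (simp add: dist_norm)
      qed
    qed
    have "(\<lambda>n. 2 * B * (\<integral>x. (norm (X n x - U n x))\<^sup>2 \<partial>M) / d'\<^sup>2) \<longlonglongrightarrow> 2 * B * 0 / d'\<^sup>2"
      using d' by (intro tendsto_intros lim) auto
    then have "\<forall>\<^sub>F n in sequentially. 2 * B * (\<integral>x. (norm (X n x - U n x))\<^sup>2 \<partial>M) / d'\<^sup>2 < e / 4"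
      using e by (intro order_tendstoD(2)[where y=0]) auto
    with U diff have "\<forall>\<^sub>F n in sequentially. norm ((\<integral>x. f (X n x) \<partial>M) - (\<integral>x. f (U n x) \<partial>M)) < e"
    proof eventually_elim
      case (elim n)
      have "\<bar>(\<integral>x. f (X n x) \<partial>M) - (\<integral>x. f (U n x) \<partial>M)\<bar> = \<bar>\<integral>x. f (X n x) - f (U n x) \<partial>M\<bar>"
        by (simp add: int)
      also have "\<dots> \<le> (\<integral>x. \<bar>f (X n x) - f (U n x)\<bar> \<partial>M)"
        by (rule integral_abs_bound)
      also have "\<dots> \<le> (\<integral>x. e / 4 + 2 * B * (norm (U n x))\<^sup>2 / R\<^sup>2 + 2 * B * (norm (X n x - U n x))\<^sup>2 / d'\<^sup>2 \<partial>M)"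
        using elim pt by (intro integral_mono) (auto intro!: integrable_abs int Bochner_Integration.integrable_diff)
      also have "\<dots> = e / 4 + 2 * B * (\<integral>x. (norm (U n x))\<^sup>2 \<partial>M) / R\<^sup>2 +
          2 * B * (\<integral>x. (norm (X n x - U n x))\<^sup>2 \<partial>M) / d'\<^sup>2"
        using elim by (simp add: prob_space)
      also have "2 * B * (\<integral>x. (norm (U n x))\<^sup>2 \<partial>M) / R\<^sup>2 \<le> 2 * B * K' / R\<^sup>2"
        using elim B0 by (intro divide_right_mono mult_left_mono) (auto simp: K'_def)
      finally show ?case
        using R2 elim e by simp
    qed
    then show "\<exists>no. \<forall>n\<ge>no. norm ((\<integral>x. f (X n x) \<partial>M) - (\<integral>x. f (U n x) \<partial>M) - 0) < e"
      by (simp add: eventually_sequentially)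
  qed
  moreover have "(\<lambda>n. \<integral>x. f (U n x) \<partial>M) \<longlonglongrightarrow> (\<integral>x. f x \<partial>\<nu>)"
    using conv f bd by (auto simp: converges_weakly_def integral_distr)
  ultimately have "(\<lambda>n. (\<integral>x. f (X n x) \<partial>M) - (\<integral>x. f (U n x) \<partial>M) + (\<integral>x. f (U n x) \<partial>M)) \<longlonglongrightarrow>
      0 + (\<integral>x. f x \<partial>\<nu>)"
    by (rule tendsto_add)
  then show "(\<lambda>n. \<integral>x. f x \<partial>distr M borel (X n)) \<longlonglongrightarrow> (\<integral>x. f x \<partial>\<nu>)"
    by (simp add: integral_distr)
qed

context prob_space
begin

lemma distr_vec_indep:
  fixes X :: "'n::finite \<Rightarrow> 'a \<Rightarrow> real"
  assumes indep: "indep_vars (\<lambda>_. borel) X UNIV"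
  shows "distr M borel (\<lambda>x. \<chi> i. X i x) = distr (PiM UNIV (\<lambda>i. distr M borel (X i))) borel vec_lambda"
proof -
  have X [measurable]: "X i \<in> borel_measurable M" for i
    using indep by (auto simp: indep_vars_def)
  have meas: "(\<lambda>x. \<lambda>i\<in>UNIV. X i x) \<in> M \<rightarrow>\<^sub>M (\<Pi>\<^sub>M i\<in>UNIV. borel)"
    by (rule measurable_restrict) simp
  have "distr M (\<Pi>\<^sub>M i\<in>UNIV. borel) (\<lambda>x. \<lambda>i\<in>UNIV. X i x) = (\<Pi>\<^sub>M i\<in>UNIV. distr M borel (X i))"
    using indep by (subst (asm) indep_vars_iff_distr_eq_PiM) auto
  then have "distr (PiM UNIV (\<lambda>i. distr M borel (X i))) borel vec_lambda =
      distr (distr M (\<Pi>\<^sub>M i\<in>(UNIV :: 'n set). borel) (\<lambda>x. \<lambda>i\<in>UNIV. X i x)) borel vec_lambda"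
    by simp
  also have "\<dots> = distr M borel (\<lambda>x. \<chi> i. X i x)"
    by (subst distr_distr) (use meas in \<open>auto simp: measurable_vec_lambda_PiM o_def restrict_UNIV\<close>)
  finally show ?thesis ..
qed

lemma converges_weakly_perturb_vec:
  fixes X U :: "nat \<Rightarrow> 'n::finite \<Rightarrow> 'a \<Rightarrow> real" and K :: real
  assumes X: "\<And>n i. X n i \<in> borel_measurable M" and U: "\<And>n i. U n i \<in> borel_measurable M"
    and conv: "converges_weakly (\<lambda>n. distr M borel (\<lambda>x. \<chi> i. U n i x)) \<nu>"
    and U2: "\<And>i. \<forall>\<^sub>F n in sequentially. integrable M (\<lambda>x. (U n i x)\<^sup>2) \<and> expectation (\<lambda>x. (U n i x)\<^sup>2) \<le> K"
    and diff: "\<And>i. \<forall>\<^sub>F n in sequentially. integrable M (\<lambda>x. (X n i x - U n i x)\<^sup>2) \<and>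
      expectation (\<lambda>x. (X n i x - U n i x)\<^sup>2) \<le> b n i"
    and b: "\<And>i. (\<lambda>n. b n i) \<longlonglongrightarrow> 0"
  shows "converges_weakly (\<lambda>n. distr M borel (\<lambda>x. \<chi> i. X n i x)) \<nu>"
proof (rule converges_weakly_perturb[OF _ _ conv])
  have norm2: "(norm (\<chi> i. v i))\<^sup>2 = (\<Sum>i\<in>UNIV. (v i)\<^sup>2)" for v :: "'n \<Rightarrow> real"
    by (simp add: norm_vec_def L2_set_def sum_nonneg)
  have sub: "(\<chi> i. v i) - (\<chi> i. v' i) = (\<chi> i. v i - v' i)" for v v' :: "'n \<Rightarrow> real"
    by (simp add: vec_eq_iff)
  have "\<forall>\<^sub>F n in sequentially. \<forall>i. integrable M (\<lambda>x. (U n i x)\<^sup>2) \<and> expectation (\<lambda>x. (U n i x)\<^sup>2) \<le> K"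
    using U2 by (rule eventually_all_finite)
  then show "\<forall>\<^sub>F n in sequentially. integrable M (\<lambda>x. (norm (\<chi> i. U n i x))\<^sup>2) \<and>
      expectation (\<lambda>x. (norm (\<chi> i. U n i x))\<^sup>2) \<le> (\<Sum>i\<in>(UNIV :: 'n set). K)"
    unfolding norm2 by eventually_elim (simp del: sum_constant add: sum_mono)
  have ev: "\<forall>\<^sub>F n in sequentially. \<forall>i. integrable M (\<lambda>x. (X n i x - U n i x)\<^sup>2) \<and>
      expectation (\<lambda>x. (X n i x - U n i x)\<^sup>2) \<le> b n i"
    using diff by (rule eventually_all_finite)
  then show "\<forall>\<^sub>F n in sequentially. integrable M (\<lambda>x. (norm ((\<chi> i. X n i x) - (\<chi> i. U n i x)))\<^sup>2)"
    unfolding sub norm2 by eventually_elim simp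
  show "(\<lambda>n. expectation (\<lambda>x. (norm ((\<chi> i. X n i x) - (\<chi> i. U n i x)))\<^sup>2)) \<longlonglongrightarrow> 0"
  proof (rule Lim_null_comparison)
    show "\<forall>\<^sub>F n in sequentially. norm (expectation (\<lambda>x. (norm ((\<chi> i. X n i x) - (\<chi> i. U n i x)))\<^sup>2)) \<le> (\<Sum>i\<in>UNIV. b n i)"
      using ev unfolding sub norm2
    proof eventually_elim
      case (elim n)
      have "norm (expectation (\<lambda>x. \<Sum>i\<in>UNIV. (X n i x - U n i x)\<^sup>2)) = expectation (\<lambda>x. \<Sum>i\<in>UNIV. (X n i x - U n i x)\<^sup>2)"
        by (simp add: sum_nonneg)
      then show ?case
        using elim by (simp add: sum_mono)
    qed
    show "(\<lambda>n. \<Sum>i\<in>UNIV. b n i) \<longlonglongrightarrow> 0"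
      using tendsto_sum[of UNIV "\<lambda>i n. b n i" "\<lambda>_. 0"] b by simp
  qed
qed (rule borel_measurable_vec_lambda, rule X U)+

end

section \<open>The central limit theorem for weighted sums\<close>

lemma (in prob_space) weak_conv_m_weighted_sum:
  fixes \<xi> :: "'i \<Rightarrow> 'a \<Rightarrow> real" and w :: "nat \<Rightarrow> 'i \<Rightarrow> real" and J :: "nat \<Rightarrow> 'i set"
  assumes indep: "indep_vars (\<lambda>_. borel) \<xi> UNIV"
    and distr: "\<And>i. distr M borel (\<xi> i) = \<mu>"
    and sq: "integrable \<mu> (\<lambda>x. x\<^sup>2)" and mean: "(\<integral>x. x \<partial>\<mu>) = 0" and var: "(\<integral>x. x\<^sup>2 \<partial>\<mu>) = V"
    and wlim: "(\<lambda>n. V * (\<Sum>j\<in>J n. (w n j)\<^sup>2)) \<longlonglongrightarrow> 1"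
    and wW: "\<forall>\<^sub>F n in sequentially. \<forall>j\<in>J n. \<bar>w n j\<bar> \<le> W n" and W: "W \<longlonglongrightarrow> 0"
  shows "weak_conv_m (\<lambda>n. distr M borel (\<lambda>x. \<Sum>j\<in>J n. w n j * \<xi> j x)) std_normal_distribution"
proof (rule levy_continuity)
  have \<xi> [measurable]: "\<xi> i \<in> borel_measurable M" for i
    using indep by (auto simp: indep_vars_def)
  show "real_distribution (distr M borel (\<lambda>x. \<Sum>j\<in>J n. w n j * \<xi> j x))" for n
    by (rule real_distribution_distr) simp
  show "real_distribution std_normal_distribution"
    by (rule real_dist_normal_dist)
  interpret \<mu>: real_distribution \<mu>
    by (subst distr[symmetric, of undefined]) (rule real_distribution_distr, simp)
  have int1: "integrable \<mu> (\<lambda>x. x)"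
    by (rule \<mu>.square_integrable_imp_integrable[OF _ sq]) simp
  have V0: "V \<ge> 0"
    unfolding var[symmetric] by simp
  fix t :: real
  define \<kappa> where "\<kappa> n = (\<integral>x. min (6 * x\<^sup>2) (\<bar>t * W n\<bar> * \<bar>x\<bar> ^ 3) \<partial>\<mu>)" for n
  have "\<kappa> \<longlonglongrightarrow> (\<integral>x. 0 \<partial>\<mu>)"
    unfolding \<kappa>_def
  proof (rule integral_dominated_convergence[where w = "\<lambda>x. 6 * x\<^sup>2"])
    have "(\<lambda>n. min (6 * x\<^sup>2) (\<bar>t * W n\<bar> * \<bar>x\<bar> ^ 3)) \<longlonglongrightarrow> min (6 * x\<^sup>2) (\<bar>t * 0\<bar> * \<bar>x\<bar> ^ 3)" for x
      by (intro tendsto_intros W)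
    then show "AE x in \<mu>. (\<lambda>n. min (6 * x\<^sup>2) (\<bar>t * W n\<bar> * \<bar>x\<bar> ^ 3)) \<longlonglongrightarrow> 0"
      by simp
  qed (use sq in auto)
  then have \<kappa>: "\<kappa> \<longlonglongrightarrow> 0"
    by simp
  define S where "S n = (\<Sum>j\<in>J n. (w n j)\<^sup>2)" for n
  have V: "V > 0"
  proof (rule ccontr)
    assume "\<not> V > 0"
    then have "V = 0" using V0 by simp
    then show False using wlim by (simp add: LIMSEQ_const_iff)
  qed
  have "(\<lambda>n. V * S n / V) \<longlonglongrightarrow> 1 / V"
    using wlim V unfolding S_def[symmetric] by (intro tendsto_intros) auto
  then have Slim: "S \<longlonglongrightarrow> 1 / V"
    using V by simp
  let ?c = "\<lambda>n. char (distr M borel (\<lambda>x. \<Sum>j\<in>J n. w n j * \<xi> j x)) t"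
  have bound: "norm (?c n - of_real (exp (- (t\<^sup>2 * (V * S n) / 2)))) \<le> t\<^sup>2 * S n * (\<kappa> n / 6 + t\<^sup>2 * V\<^sup>2 * (W n)\<^sup>2 / 4)"
    if n: "\<forall>j\<in>J n. \<bar>w n j\<bar> \<le> W n" for n
  proof -
    have c: "?c n = (\<Prod>j\<in>J n. char \<mu> (t * w n j))"
    proof -
      have "?c n = (\<Prod>j\<in>J n. char (distr M borel (\<lambda>x. w n j * \<xi> j x)) t)"
        by (rule char_distr_sum)
          (rule indep_vars_compose2[where X=\<xi>, OF indep_vars_subset[OF indep]], auto)
      also have "\<dots> = (\<Prod>j\<in>J n. char \<mu> (t * w n j))"
      proof (rule prod.cong[OF refl])
        fix j
        have "char \<mu> (t * w n j) = char (distr M borel (\<xi> j)) (t * w n j)"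
          by (simp add: distr)
        then show "char (distr M borel (\<lambda>x. w n j * \<xi> j x)) t = char \<mu> (t * w n j)"
          by (simp add: char_def integral_distr mult_ac)
      qed
      finally show ?thesis .
    qed
    have e: "exp (- (t\<^sup>2 * (V * S n) / 2)) = (\<Prod>j\<in>J n. exp (- ((t * w n j)\<^sup>2 * V / 2)))"
    proof (cases "finite (J n)")
      case True
      then show ?thesis
        by (simp add: exp_sum[symmetric] S_def sum_distrib_left sum_divide_distrib sum_negf power_mult_distrib mult_ac)
    qed (simp add: S_def)
    have "norm (?c n - of_real (exp (- (t\<^sup>2 * (V * S n) / 2)))) \<le>
        (\<Sum>j\<in>J n. norm (char \<mu> (t * w n j) - of_real (exp (- ((t * w n j)\<^sup>2 * V / 2)))))"
      unfolding c e of_real_prod using V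
      by (intro norm_prod_diff) (auto simp: \<mu>.cmod_char_le_1)
    also have "\<dots> \<le> (\<Sum>j\<in>J n. (w n j)\<^sup>2 * (t\<^sup>2 * (\<kappa> n / 6 + t\<^sup>2 * V\<^sup>2 * (W n)\<^sup>2 / 4)))"
    proof (rule sum_mono)
      fix j assume j: "j \<in> J n"
      let ?s = "t * w n j"
      have 1: "norm (char \<mu> ?s - (1 - ?s\<^sup>2 * V / 2)) \<le> ?s\<^sup>2 / 6 * (\<integral>x. min (6 * x\<^sup>2) (\<bar>?s\<bar> * \<bar>x\<bar> ^ 3) \<partial>\<mu>)"
        using int1 mean sq var by (intro \<mu>.char_approx3) auto
      have W0: "\<bar>w n j\<bar> \<le> W n" using n j by auto
      have im: "integrable \<mu> (\<lambda>x. min (6 * x\<^sup>2) (\<bar>a\<bar> * \<bar>x\<bar> ^ 3))" for a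
        by (rule Bochner_Integration.integrable_bound[where f="\<lambda>x. 6 * x\<^sup>2"]) (use sq in auto)
      have "(\<integral>x. min (6 * x\<^sup>2) (\<bar>?s\<bar> * \<bar>x\<bar> ^ 3) \<partial>\<mu>) \<le> \<kappa> n"
        unfolding \<kappa>_def using W0
        by (intro integral_mono im min.mono mult_right_mono order_refl)
           (auto simp: abs_mult intro!: mult_left_mono)
      then have 2: "norm (char \<mu> ?s - (1 - ?s\<^sup>2 * V / 2)) \<le> ?s\<^sup>2 / 6 * \<kappa> n"
        using 1 by (meson divide_nonneg_nonneg mult_left_mono order_trans zero_le_power2 zero_le_numeral)
      define y where "y = ?s\<^sup>2 * V / 2"
      have y: "y \<ge> 0" using V by (simp add: y_def)
      have "1 - y \<le> exp (- y)"
        using exp_ge_add_one_self[of "-y"] by simp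
      then have "\<bar>(1 - y) - exp (- y)\<bar> \<le> y\<^sup>2"
        using exp_minus_le_quadratic[OF y] by simp
      also have "y\<^sup>2 = (w n j)\<^sup>2 * (t\<^sup>2 * (t\<^sup>2 * V\<^sup>2 * (w n j)\<^sup>2 / 4))"
        by (simp add: y_def power2_eq_square)
      also have "\<dots> \<le> (w n j)\<^sup>2 * (t\<^sup>2 * (t\<^sup>2 * V\<^sup>2 * (W n)\<^sup>2 / 4))"
        using W0 power_mono[OF W0, of 2] by (intro mult_left_mono divide_right_mono) auto
      finally have 3: "\<bar>(1 - y) - exp (- y)\<bar> \<le> (w n j)\<^sup>2 * (t\<^sup>2 * (t\<^sup>2 * V\<^sup>2 * (W n)\<^sup>2 / 4))" .
      have "norm (char \<mu> ?s - of_real (exp (- y))) =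
          norm ((char \<mu> ?s - of_real (1 - y)) + of_real ((1 - y) - exp (- y)))"
        by (simp add: algebra_simps)
      also have "\<dots> \<le> norm (char \<mu> ?s - of_real (1 - y)) + \<bar>(1 - y) - exp (- y)\<bar>"
        by (rule norm_triangle_le) (simp only: norm_of_real order_refl)
      also have "\<dots> \<le> ?s\<^sup>2 / 6 * \<kappa> n + (w n j)\<^sup>2 * (t\<^sup>2 * (t\<^sup>2 * V\<^sup>2 * (W n)\<^sup>2 / 4))"
        using 2 3 by (intro add_mono) (auto simp: y_def)
      also have "\<dots> = (w n j)\<^sup>2 * (t\<^sup>2 * (\<kappa> n / 6 + t\<^sup>2 * V\<^sup>2 * (W n)\<^sup>2 / 4))"
        by (simp add: field_simps power2_eq_square)
      finally show "norm (char \<mu> ?s - of_real (exp (- (?s\<^sup>2 * V / 2)))) \<le>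
        (w n j)\<^sup>2 * (t\<^sup>2 * (\<kappa> n / 6 + t\<^sup>2 * V\<^sup>2 * (W n)\<^sup>2 / 4))"
        unfolding y_def .
    qed
    also have "\<dots> = t\<^sup>2 * S n * (\<kappa> n / 6 + t\<^sup>2 * V\<^sup>2 * (W n)\<^sup>2 / 4)"
      unfolding S_def sum_distrib_right[symmetric] by (simp only: mult_ac)
    finally show ?thesis .
  qed
  have "(\<lambda>n. t\<^sup>2 * S n * (\<kappa> n / 6 + t\<^sup>2 * V\<^sup>2 * (W n)\<^sup>2 / 4)) \<longlonglongrightarrow>
      t\<^sup>2 * (1 / V) * (0 / 6 + t\<^sup>2 * V\<^sup>2 * 0\<^sup>2 / 4)"
    by (intro tendsto_intros Slim \<kappa> W) auto
  then have "(\<lambda>n. t\<^sup>2 * S n * (\<kappa> n / 6 + t\<^sup>2 * V\<^sup>2 * (W n)\<^sup>2 / 4)) \<longlonglongrightarrow> 0"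
    by simp
  then have "(\<lambda>n. ?c n - of_real (exp (- (t\<^sup>2 * (V * S n) / 2)))) \<longlonglongrightarrow> 0"
    by (rule Lim_null_comparison[rotated]) (use wW bound in \<open>auto elim: eventually_mono\<close>)
  moreover have "(\<lambda>n. complex_of_real (exp (- (t\<^sup>2 * (V * S n) / 2)))) \<longlonglongrightarrow>
      complex_of_real (exp (- (t\<^sup>2 * 1 / 2)))"
    using wlim unfolding S_def[symmetric] by (intro tendsto_intros) auto
  ultimately have "(\<lambda>n. ?c n - of_real (exp (- (t\<^sup>2 * (V * S n) / 2))) + of_real (exp (- (t\<^sup>2 * (V * S n) / 2))))
      \<longlonglongrightarrow> 0 + complex_of_real (exp (- (t\<^sup>2 * 1 / 2)))"
    by (rule tendsto_add)
  then show "?c \<longlonglongrightarrow> char std_normal_distribution t"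
    by (simp add: char_std_normal_distribution)
qed

section \<open>Second moments\<close>

context prob_space
begin

lemma second_moment_affine_indep:
  fixes A B Z :: "'a \<Rightarrow> real"
  assumes i1: "indep_var borel (\<lambda>x. A x * B x) borel Z" and BZ: "indep_var borel B borel Z"
    and [measurable]: "A \<in> borel_measurable M" and A2: "integrable M (\<lambda>x. (A x)\<^sup>2)" and B2: "integrable M (\<lambda>x. (B x)\<^sup>2)"
    and Z2: "integrable M (\<lambda>x. (Z x)\<^sup>2)" and Z0: "expectation Z = 0"
  shows "integrable M (\<lambda>x. (A x + B x * Z x)\<^sup>2)" (is ?int)
    and "expectation (\<lambda>x. (A x + B x * Z x)\<^sup>2) =
      expectation (\<lambda>x. (A x)\<^sup>2) + expectation (\<lambda>x. (B x)\<^sup>2) * expectation (\<lambda>x. (Z x)\<^sup>2)" (is ?eq)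
proof -
  have [measurable]: "B \<in> borel_measurable M" "Z \<in> borel_measurable M"
    using indep_var_rv1[OF BZ] indep_var_rv2[OF BZ] .
  have Z1: "integrable M Z"
    by (rule square_integrable_imp_integrable[OF _ Z2]) simp
  have AB1: "integrable M (\<lambda>x. A x * B x)"
  proof (rule Bochner_Integration.integrable_bound)
    show "integrable M (\<lambda>x. (A x)\<^sup>2 + (B x)\<^sup>2)" using A2 B2 by simp
    have "\<bar>a * b\<bar> \<le> a\<^sup>2 + b\<^sup>2" for a b :: real
    proof -
      have "2 * (\<bar>a\<bar> * \<bar>b\<bar>) \<le> a\<^sup>2 + b\<^sup>2"
        using sum_squares_bound[of "\<bar>a\<bar>" "\<bar>b\<bar>"] by simp
      then show ?thesis by (simp add: abs_mult) (use mult_nonneg_nonneg[of "\<bar>a\<bar>" "\<bar>b\<bar>"] in linarith)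
    qed
    then show "AE x in M. norm (A x * B x) \<le> norm ((A x)\<^sup>2 + (B x)\<^sup>2)"
      by (simp add: abs_mult)
  qed simp
  have i2: "indep_var borel (\<lambda>x. (B x)\<^sup>2) borel (\<lambda>x. (Z x)\<^sup>2)"
    using indep_var_compose[OF BZ, of "\<lambda>z. z\<^sup>2" borel "\<lambda>z. z\<^sup>2" borel] by (simp add: o_def)
  have e: "(\<lambda>x. (A x + B x * Z x)\<^sup>2) = (\<lambda>x. (A x)\<^sup>2 + 2 * ((A x * B x) * Z x) + (B x)\<^sup>2 * (Z x)\<^sup>2)"
    by (auto simp: power2_eq_square algebra_simps)
  note int = indep_var_integrable[OF i1 AB1 Z1] indep_var_integrable[OF i2 B2 Z2]
  show ?int unfolding e using int A2 by simp
  show ?eq unfolding e using int A2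
    by (simp add: indep_var_lebesgue_integral[OF i1 AB1 Z1] indep_var_lebesgue_integral[OF i2 B2 Z2] Z0)
qed

lemma indep_var_other:
  fixes \<xi> :: "'i \<Rightarrow> 'a \<Rightarrow> real"
  assumes indep: "indep_vars (\<lambda>_. borel) \<xi> UNIV" and "k \<notin> J"
    and F: "F \<in> borel_measurable (PiM J (\<lambda>_. borel))"
  shows "indep_var borel (\<lambda>x. F (restrict (\<lambda>i. \<xi> i x) J)) borel (\<xi> k)"
proof -
  have "indep_var borel (F \<circ> (\<lambda>x. restrict (\<lambda>i. \<xi> i x) J)) borel ((\<lambda>f. f k) \<circ> (\<lambda>x. restrict (\<lambda>i. \<xi> i x) {k}))"
    using assms by (intro indep_var_compose[OF indep_var_restrict[OF indep]]) auto
  then show ?thesis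
    by (simp add: o_def)
qed

lemma second_moment_weighted_sum:
  fixes \<xi> :: "'i \<Rightarrow> 'a \<Rightarrow> real"
  assumes indep: "indep_vars (\<lambda>_. borel) \<xi> UNIV"
    and sq: "\<And>i. integrable M (\<lambda>x. (\<xi> i x)\<^sup>2)" and mean: "\<And>i. expectation (\<xi> i) = 0"
    and var: "\<And>i. expectation (\<lambda>x. (\<xi> i x)\<^sup>2) = V" and "finite J"
  shows "integrable M (\<lambda>x. (\<Sum>j\<in>J. a j * \<xi> j x)\<^sup>2) \<and>
    expectation (\<lambda>x. (\<Sum>j\<in>J. a j * \<xi> j x)\<^sup>2) = V * (\<Sum>j\<in>J. (a j)\<^sup>2)"
  using \<open>finite J\<close>
proof (induction J)
  case empty
  then show ?case by simp
next
  case (insert k J)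
  have \<xi> [measurable]: "\<xi> i \<in> borel_measurable M" for i
    using indep by (auto simp: indep_vars_def)
  have "indep_var borel (\<lambda>x. (\<Sum>i\<in>J. a i * restrict (\<lambda>i. \<xi> i x) J i) * a k) borel (\<xi> k)"
    using insert by (intro indep_var_other[OF indep, where J=J]) auto
  then have i: "indep_var borel (\<lambda>x. (\<Sum>i\<in>J. a i * \<xi> i x) * a k) borel (\<xi> k)"
    by simp
  have j: "indep_var borel (\<lambda>_. a k) borel (\<xi> k)"
    using insert by (intro indep_var_other[OF indep, where J=J]) auto
  show ?case
    using second_moment_affine_indep[OF i j _ _ _ sq mean] insert
    by (simp add: var prob_space algebra_simps)
qed

end

section \<open>The linearised volatility recursion\<close>

text \<open>With \<open>h = -\<gamma>\<close>, noise \<open>\<xi>\<^sub>j = \<epsilon>\<^sub>j\<^sup>2 - 1\<close> and \<open>u\<^sub>0 = h \<sigma>\<^sub>0\<^sup>2 / \<omega> - 1\<close>, the squared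
  volatility is \<open>\<sigma>\<^sub>k\<^sup>2 / \<omega> = (1 + u\<^sub>k) / h\<close>.\<close>

primrec vol_dev :: "real \<Rightarrow> real \<Rightarrow> real \<Rightarrow> (nat \<Rightarrow> real) \<Rightarrow> nat \<Rightarrow> real" where
  "vol_dev h a u\<^sub>0 e 0 = u\<^sub>0"
| "vol_dev h a u\<^sub>0 e (Suc k) = (1 - h) * vol_dev h a u\<^sub>0 e k + a * (1 + vol_dev h a u\<^sub>0 e k) * e k"

text \<open>The error of linearising \<open>vol_dev\<close> in the noise.\<close>

primrec vol_rem :: "real \<Rightarrow> real \<Rightarrow> real \<Rightarrow> (nat \<Rightarrow> real) \<Rightarrow> nat \<Rightarrow> real" where
  "vol_rem h a u\<^sub>0 e 0 = 0"
| "vol_rem h a u\<^sub>0 e (Suc k) = (1 - h) * vol_rem h a u\<^sub>0 e k + a * vol_dev h a u\<^sub>0 e k * e k"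

lemma garch_sigma_eq_vol_dev:
  assumes "\<omega> > 0" "a \<ge> 0" "b \<ge> 0" and h: "h = 1 - a - b" "h \<noteq> 0"
  shows "(garch_sigma \<omega> a b \<sigma>\<^sub>0 e k)\<^sup>2 / \<omega> =
    (1 + vol_dev h a (h * \<sigma>\<^sub>0\<^sup>2 / \<omega> - 1) (\<lambda>j. (e j)\<^sup>2 - 1) k) / h"
proof (induction k)
  case 0
  then show ?case using assms(1) h(2) by simp
next
  case (Suc k)
  let ?s = "garch_sigma \<omega> a b \<sigma>\<^sub>0 e k"
  let ?u = "vol_dev h a (h * \<sigma>\<^sub>0\<^sup>2 / \<omega> - 1) (\<lambda>j. (e j)\<^sup>2 - 1) k"
  have "(garch_sigma \<omega> a b \<sigma>\<^sub>0 e (Suc k))\<^sup>2 = \<omega> + a * (?s * e k)\<^sup>2 + b * ?s\<^sup>2"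
    using garch_sigma_Suc_squared[of \<omega> a b \<sigma>\<^sub>0 e k] assms by (simp add: garch_y_def)
  then have "(garch_sigma \<omega> a b \<sigma>\<^sub>0 e (Suc k))\<^sup>2 / \<omega> = 1 + (a * (e k)\<^sup>2 + b) * (?s\<^sup>2 / \<omega>)"
    using assms(1) by (simp add: field_simps power_mult_distrib)
  also have "\<dots> = 1 + (a * (e k)\<^sup>2 + b) * ((1 + ?u) / h)"
    by (simp only: Suc)
  also have "\<dots> = (h + (a * (e k)\<^sup>2 + b) * (1 + ?u)) / h"
    using h(2) by (simp add: field_simps)
  also have "h + (a * (e k)\<^sup>2 + b) * (1 + ?u) = 1 + ((1 - h) * ?u + a * (1 + ?u) * ((e k)\<^sup>2 - 1))"
    unfolding h(1) by (simp add: algebra_simps)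
  finally show ?case by simp
qed

lemma vol_dev_decomposition:
  "vol_dev h a u\<^sub>0 e k =
    (1 - h) ^ k * u\<^sub>0 + a * (\<Sum>j<k. (1 - h) ^ (k - 1 - j) * e j) + vol_rem h a u\<^sub>0 e k"
proof (induction k)
  case (Suc k)
  have "(\<Sum>j<k. (1 - h) ^ (k - j) * e j) = (1 - h) * (\<Sum>j<k. (1 - h) ^ (k - 1 - j) * e j)"
    unfolding sum_distrib_left
  proof (rule sum.cong[OF refl])
    fix j assume "j \<in> {..<k}"
    then have "k - j = Suc (k - 1 - j)" by auto
    then show "(1 - h) ^ (k - j) * e j = (1 - h) * ((1 - h) ^ (k - 1 - j) * e j)"
      by (simp only: power_Suc mult.assoc)
  qed
  then have S: "(\<Sum>j<Suc k. (1 - h) ^ (Suc k - 1 - j) * e j) =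
      (1 - h) * (\<Sum>j<k. (1 - h) ^ (k - 1 - j) * e j) + e k"
    by simp
  have "vol_dev h a u\<^sub>0 e (Suc k) = (1 - h) * vol_dev h a u\<^sub>0 e k + a * e k + a * vol_dev h a u\<^sub>0 e k * e k"
    by (simp add: algebra_simps)
  also have "(1 - h) * vol_dev h a u\<^sub>0 e k = (1 - h) * ((1 - h) ^ k * u\<^sub>0 +
      a * (\<Sum>j<k. (1 - h) ^ (k - 1 - j) * e j) + vol_rem h a u\<^sub>0 e k)"
    by (simp only: Suc)
  finally show ?case
    unfolding S vol_rem.simps by (simp add: algebra_simps)
qed simp

lemma vol_dev_restrict: "k \<le> m \<Longrightarrow> vol_dev h a u\<^sub>0 (restrict e {..<m}) k = vol_dev h a u\<^sub>0 e k"
  by (induction k) auto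

lemma vol_rem_restrict: "k \<le> m \<Longrightarrow> vol_rem h a u\<^sub>0 (restrict e {..<m}) k = vol_rem h a u\<^sub>0 e k"
  by (induction k) (auto simp: vol_dev_restrict)

lemma measurable_vol_dev:
  "k \<le> m \<Longrightarrow> (\<lambda>e. vol_dev h a u\<^sub>0 e k) \<in> borel_measurable (PiM {..<m} (\<lambda>_. borel))"
proof (induction k)
  case (Suc k)
  then have [measurable]: "(\<lambda>e. vol_dev h a u\<^sub>0 e k) \<in> borel_measurable (PiM {..<m} (\<lambda>_. borel))"
    and k: "k \<in> {..<m}" by auto
  have [measurable]: "(\<lambda>e. e k) \<in> borel_measurable (PiM {..<m} (\<lambda>_. borel))"
    using k by (rule measurable_component_singleton)
  show ?case by simp
qed simp

lemma measurable_vol_rem: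
  "k \<le> m \<Longrightarrow> (\<lambda>e. vol_rem h a u\<^sub>0 e k) \<in> borel_measurable (PiM {..<m} (\<lambda>_. borel))"
proof (induction k)
  case (Suc k)
  then have [measurable]: "(\<lambda>e. vol_rem h a u\<^sub>0 e k) \<in> borel_measurable (PiM {..<m} (\<lambda>_. borel))"
    "(\<lambda>e. vol_dev h a u\<^sub>0 e k) \<in> borel_measurable (PiM {..<m} (\<lambda>_. borel))"
    and k: "k \<in> {..<m}" by (auto intro: measurable_vol_dev)
  have [measurable]: "(\<lambda>e. e k) \<in> borel_measurable (PiM {..<m} (\<lambda>_. borel))"
    using k by (rule measurable_component_singleton)
  show ?case by simp
qed simp

locale centered_noise = prob_space +
  fixes \<xi> :: "nat \<Rightarrow> 'a \<Rightarrow> real" and V :: real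
  assumes indep: "indep_vars (\<lambda>_. borel) \<xi> UNIV"
    and sq: "integrable M (\<lambda>x. (\<xi> i x)\<^sup>2)" and mean: "expectation (\<xi> i) = 0"
    and var: "expectation (\<lambda>x. (\<xi> i x)\<^sup>2) = V"
begin

lemma measurable_noise [measurable]: "\<xi> i \<in> borel_measurable M"
  using indep by (auto simp: indep_vars_def)

lemma V_nonneg: "V \<ge> 0"
  unfolding var[of 0, symmetric] by simp

lemma measurable_vol_dev_noise [measurable]: "(\<lambda>x. vol_dev h a u\<^sub>0 (\<lambda>i. \<xi> i x) k) \<in> borel_measurable M"
  by (induction k) simp_all

lemma measurable_vol_rem_noise [measurable]: "(\<lambda>x. vol_rem h a u\<^sub>0 (\<lambda>i. \<xi> i x) k) \<in> borel_measurable M"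
  by (induction k) simp_all

lemma indep_var_past:
  assumes F: "F \<in> borel_measurable (borel \<Otimes>\<^sub>M borel)"
  shows "indep_var borel (\<lambda>x. F (vol_dev h a u\<^sub>0 (\<lambda>i. \<xi> i x) k, vol_rem h a u\<^sub>0 (\<lambda>i. \<xi> i x) k)) borel (\<xi> k)"
proof -
  note [measurable] = F measurable_vol_dev[OF order_refl] measurable_vol_rem[OF order_refl]
  have "indep_var borel
      (\<lambda>x. F (vol_dev h a u\<^sub>0 (restrict (\<lambda>i. \<xi> i x) {..<k}) k, vol_rem h a u\<^sub>0 (restrict (\<lambda>i. \<xi> i x) {..<k}) k))
      borel (\<xi> k)"
    by (rule indep_var_other[OF indep, where J = "{..<k}"]) simp_all
  then show ?thesis
    by (simp add: vol_dev_restrict vol_rem_restrict)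
qed

context
  fixes h a u\<^sub>0 :: real
  assumes h: "0 < h" "h \<le> 1" and a: "4 * a\<^sup>2 * V \<le> h"
begin

abbreviation "u k x \<equiv> vol_dev h a u\<^sub>0 (\<lambda>i. \<xi> i x) k"
abbreviation "r k x \<equiv> vol_rem h a u\<^sub>0 (\<lambda>i. \<xi> i x) k"

lemma second_moment_vol_dev:
  "integrable M (\<lambda>x. (u k x)\<^sup>2) \<and>
    expectation (\<lambda>x. (u k x)\<^sup>2) \<le> (1 - h / 2) ^ k * u\<^sub>0\<^sup>2 + 4 * a\<^sup>2 * V / h"
proof (induction k)
  case 0
  then show ?case using h V_nonneg by (simp add: prob_space)
next
  case (Suc k)
  let ?U = "expectation (\<lambda>x. (u k x)\<^sup>2)"
  have int: "integrable M (\<lambda>x. (u k x)\<^sup>2)" using Suc by simp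
  have int1: "integrable M (u k)"
    by (rule square_integrable_imp_integrable[OF _ int]) simp
  have e: "(a * (1 + z))\<^sup>2 = a\<^sup>2 + 2 * a\<^sup>2 * z + a\<^sup>2 * z\<^sup>2" for z
    by (simp add: power2_eq_square algebra_simps)
  have i1: "indep_var borel (\<lambda>x. ((1 - h) * u k x) * (a * (1 + u k x))) borel (\<xi> k)"
    using indep_var_past[of "\<lambda>(u, r). ((1 - h) * u) * (a * (1 + u))" h a u\<^sub>0 k] by simp
  have i2: "indep_var borel (\<lambda>x. a * (1 + u k x)) borel (\<xi> k)"
    using indep_var_past[of "\<lambda>(u, r). a * (1 + u)" h a u\<^sub>0 k] by simp
  have B2: "integrable M (\<lambda>x. (a * (1 + u k x))\<^sup>2)"
    unfolding e using int int1 by simp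
  have A2: "integrable M (\<lambda>x. ((1 - h) * u k x)\<^sup>2)"
    using int by (simp add: power_mult_distrib)
  note step = second_moment_affine_indep[OF i1 i2 _ A2 B2 sq mean]
  have "expectation (\<lambda>x. (a * (1 + u k x))\<^sup>2) \<le> expectation (\<lambda>x. 2 * a\<^sup>2 + 2 * a\<^sup>2 * (u k x)\<^sup>2)"
  proof (rule integral_mono[OF B2])
    have "(1 + z)\<^sup>2 \<le> 2 + 2 * z\<^sup>2" for z :: real
      using sum_squares_bound[of 1 z] by (simp add: power2_sum)
    then show "(a * (1 + u k x))\<^sup>2 \<le> 2 * a\<^sup>2 + 2 * a\<^sup>2 * (u k x)\<^sup>2" for x
      using mult_left_mono[of "(1 + u k x)\<^sup>2" "2 + 2 * (u k x)\<^sup>2" "a\<^sup>2"]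
      unfolding power_mult_distrib by (simp add: distrib_left mult_ac)
  qed (use int in simp)
  also have "\<dots> = 2 * a\<^sup>2 + 2 * a\<^sup>2 * ?U"
    using int by (simp add: prob_space)
  finally have B: "expectation (\<lambda>x. (a * (1 + u k x))\<^sup>2) * V \<le> (2 * a\<^sup>2 + 2 * a\<^sup>2 * ?U) * V"
    using V_nonneg by (rule mult_right_mono)
  have U0: "?U \<ge> 0" by simp
  have "expectation (\<lambda>x. (u (Suc k) x)\<^sup>2) = (1 - h)\<^sup>2 * ?U + expectation (\<lambda>x. (a * (1 + u k x))\<^sup>2) * V"
    using step(2) by (simp add: var power_mult_distrib)
  also have "\<dots> \<le> (1 - h)\<^sup>2 * ?U + (2 * a\<^sup>2 + 2 * a\<^sup>2 * ?U) * V"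
    using B by simp
  also have "\<dots> = ((1 - h)\<^sup>2 + 2 * a\<^sup>2 * V) * ?U + 2 * a\<^sup>2 * V"
    by (simp add: algebra_simps)
  also have "\<dots> \<le> (1 - h / 2) * ?U + 2 * a\<^sup>2 * V"
  proof -
    have "(1 - h)\<^sup>2 \<le> 1 - h"
      using h by (simp add: power2_eq_square mult_left_le)
    then have "(1 - h)\<^sup>2 + 2 * a\<^sup>2 * V \<le> 1 - h / 2"
      using a by simp
    then show ?thesis
      using U0 by (intro add_right_mono mult_right_mono)
  qed
  also have "\<dots> \<le> (1 - h / 2) * ((1 - h / 2) ^ k * u\<^sub>0\<^sup>2 + 4 * a\<^sup>2 * V / h) + 2 * a\<^sup>2 * V"
    using Suc h by (intro add_right_mono mult_left_mono) auto
  also have "\<dots> = (1 - h / 2) ^ Suc k * u\<^sub>0\<^sup>2 + 4 * a\<^sup>2 * V / h"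
    using h by (simp add: field_simps)
  finally show ?case
    using step(1) by simp
qed

lemma second_moment_vol_rem:
  "integrable M (\<lambda>x. (r k x)\<^sup>2) \<and>
    expectation (\<lambda>x. (r k x)\<^sup>2) \<le> a\<^sup>2 * V * (2 / h * u\<^sub>0\<^sup>2 * (1 - h / 2) ^ k + 4 * a\<^sup>2 * V / h\<^sup>2)"
proof (induction k)
  case 0
  then show ?case using h V_nonneg by simp
next
  case (Suc k)
  let ?R = "expectation (\<lambda>x. (r k x)\<^sup>2)" and ?U = "expectation (\<lambda>x. (u k x)\<^sup>2)"
  let ?p = "1 - h / 2" and ?w = "4 * a\<^sup>2 * V / h"
  have i1: "indep_var borel (\<lambda>x. ((1 - h) * r k x) * (a * u k x)) borel (\<xi> k)"
    using indep_var_past[of "\<lambda>(u, r). ((1 - h) * r) * (a * u)" h a u\<^sub>0 k] by simp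
  have i2: "indep_var borel (\<lambda>x. a * u k x) borel (\<xi> k)"
    using indep_var_past[of "\<lambda>(u, r). a * u" h a u\<^sub>0 k] by simp
  have A2: "integrable M (\<lambda>x. ((1 - h) * r k x)\<^sup>2)"
    using Suc by (simp add: power_mult_distrib)
  have B2: "integrable M (\<lambda>x. (a * u k x)\<^sup>2)"
    using second_moment_vol_dev by (simp add: power_mult_distrib)
  note step = second_moment_affine_indep[OF i1 i2 _ A2 B2 sq mean]
  have "expectation (\<lambda>x. (r (Suc k) x)\<^sup>2) = (1 - h)\<^sup>2 * ?R + a\<^sup>2 * V * ?U"
    using step(2) by (simp add: var power_mult_distrib)
  also have "\<dots> \<le> (1 - h) * (a\<^sup>2 * V * (2 / h * u\<^sub>0\<^sup>2 * ?p ^ k + ?w / h)) + a\<^sup>2 * V * (?p ^ k * u\<^sub>0\<^sup>2 + ?w)"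
  proof (rule add_mono)
    have "(1 - h)\<^sup>2 \<le> 1 - h"
      using h by (simp add: power2_eq_square mult_left_le)
    then show "(1 - h)\<^sup>2 * ?R \<le> (1 - h) * (a\<^sup>2 * V * (2 / h * u\<^sub>0\<^sup>2 * ?p ^ k + ?w / h))"
      using Suc h by (intro mult_mono) (auto simp: power2_eq_square)
    show "a\<^sup>2 * V * ?U \<le> a\<^sup>2 * V * (?p ^ k * u\<^sub>0\<^sup>2 + ?w)"
      using second_moment_vol_dev[of k] V_nonneg by (intro mult_left_mono) auto
  qed
  also have "\<dots> = a\<^sup>2 * V * ((2 / h * u\<^sub>0\<^sup>2 * ?p ^ k) * (1 - h + h / 2) + (?w / h) * (1 - h + h))"
    using h(1) by (simp add: field_simps)
  also have "\<dots> = a\<^sup>2 * V * (2 / h * u\<^sub>0\<^sup>2 * ?p ^ Suc k + 4 * a\<^sup>2 * V / h\<^sup>2)"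
    using h(1) by (simp add: power2_eq_square)
  finally show ?case
    using step(1) by simp
qed

end

end

context centered_noise
begin

lemma second_moment_block:
  assumes h: "0 < h" "h < 2" and V: "V > 0"
  shows "V * (\<Sum>j\<in>{p..<k}. (sqrt (2 * h / V) * (1 - h) ^ (k - 1 - j))\<^sup>2) = 2 * (1 - ((1 - h) ^ (k - p))\<^sup>2) / (2 - h)"
proof -
  have g: "(1 - h)\<^sup>2 \<noteq> 1"
    using h by (auto simp: power2_eq_1_iff)
  have "V * (\<Sum>j\<in>{p..<k}. (sqrt (2 * h / V) * (1 - h) ^ (k - 1 - j))\<^sup>2) =
      2 * h * (\<Sum>j\<in>{p..<k}. ((1 - h)\<^sup>2) ^ (k - 1 - j))"
    using h V by (simp add: power_mult_distrib sum_distrib_left power_mult[symmetric] mult.commute)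
  also have "\<dots> = 2 * h * ((1 - ((1 - h)\<^sup>2) ^ (k - p)) / (1 - (1 - h)\<^sup>2))"
    unfolding sum_power_rev_ivl using g by (simp add: sum_gp_strict)
  also have "1 - (1 - h)\<^sup>2 = h * (2 - h)"
    by (simp add: power2_eq_square algebra_simps)
  finally show ?thesis
    using h by (simp add: power_mult[symmetric] mult.commute)
qed

lemma component_error:
  assumes h: "0 < h" "h \<le> 1" and a: "0 < a" "4 * a\<^sup>2 * V \<le> h" and V: "V > 0"
    and x0: "0 \<le> x\<^sub>0" and pk: "p \<le> k"
  defines "c \<equiv> sqrt (2 * h ^ 3) / a"
  defines "X \<equiv> (\<lambda>x. c * (1 / sqrt V) * ((1 + vol_dev h a (h * x\<^sub>0 - 1) (\<lambda>i. \<xi> i x) k) / h -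
    (\<Sum>j = 1..k - 1. exp (real j * - h))))"
  defines "U \<equiv> (\<lambda>x. \<Sum>j\<in>{p..<k}. (sqrt (2 * h / V) * (1 - h) ^ (k - 1 - j)) * \<xi> j x)"
  shows "integrable M (\<lambda>x. (X x - U x)\<^sup>2) \<and>
    expectation (\<lambda>x. (X x - U x)\<^sup>2) \<le> 3 * (4 * (1 + x\<^sub>0)\<^sup>2 * (1 - h / 2) ^ k + 8 * a\<^sup>2 * V / h +
      2 * (1 - h) ^ (k - p) + c\<^sup>2 / V * (1 + x\<^sub>0)\<^sup>2)"
proof -
  define u0 where "u0 = h * x\<^sub>0 - 1"
  define w where "w j = sqrt (2 * h / V) * (1 - h) ^ (k - 1 - j)" for j
  define R where "R x = c / (h * sqrt V) * vol_rem h a u0 (\<lambda>i. \<xi> i x) k" for x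
  define L where "L x = (\<Sum>j<p. w j * \<xi> j x)" for x
  define b where "b = c / sqrt V * ((1 + (1 - h) ^ k * u0) / h - (\<Sum>j = 1..k - 1. exp (real j * - h)))"
  have c2: "c\<^sup>2 = 2 * h ^ 3 / a\<^sup>2"
    using h by (simp add: c_def power_divide)
  have ca: "c * a / (h * sqrt V) = sqrt (2 * h / V)"
  proof -
    have "2 * h ^ 3 = (2 * h) * h\<^sup>2"
      by (simp add: power3_eq_cube power2_eq_square)
    then have "sqrt (2 * h ^ 3) = sqrt (2 * h) * sqrt (h\<^sup>2)"
      by (simp only: real_sqrt_mult)
    then show ?thesis
      using h a V by (simp add: c_def real_sqrt_divide)
  qed
  have decomp: "X x - U x = R x + L x + b" for x
  proof -
    let ?S = "\<lambda>A. \<Sum>j\<in>A. (1 - h) ^ (k - 1 - j) * \<xi> j x"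
    have "X x = c / (h * sqrt V) * (vol_rem h a u0 (\<lambda>i. \<xi> i x) k + a * ?S {..<k}) + b"
      unfolding X_def b_def u0_def[symmetric] vol_dev_decomposition[of h a u0 _ k]
      by (simp add: divide_inverse algebra_simps)
    also have "\<dots> = R x + (c * a / (h * sqrt V)) * ?S {..<k} + b"
      by (simp add: R_def distrib_left)
    also have "?S {..<k} = ?S {..<p} + ?S {p..<k}"
      using pk by (simp only: lessThan_atLeast0 sum.atLeastLessThan_concat)
    finally show ?thesis
      unfolding ca by (simp add: L_def U_def w_def distrib_left sum_distrib_left mult.assoc)
  qed
  have R: "integrable M (\<lambda>x. (R x)\<^sup>2)"
    and ER: "expectation (\<lambda>x. (R x)\<^sup>2) \<le> 4 * (1 + x\<^sub>0)\<^sup>2 * (1 - h / 2) ^ k + 8 * a\<^sup>2 * V / h"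
  proof -
    note m = second_moment_vol_rem[OF h a(2), of u0 k]
    show "integrable M (\<lambda>x. (R x)\<^sup>2)"
      unfolding R_def power_mult_distrib using m by simp
    have "(c / (h * sqrt V))\<^sup>2 = 2 * h / (a\<^sup>2 * V)"
      unfolding power_divide power_mult_distrib c2
      using h V a by (simp add: power3_eq_cube power2_eq_square)
    then have "expectation (\<lambda>x. (R x)\<^sup>2) = 2 * h / (a\<^sup>2 * V) * expectation (\<lambda>x. (vol_rem h a u0 (\<lambda>i. \<xi> i x) k)\<^sup>2)"
      unfolding R_def power_mult_distrib by simp
    also have "\<dots> \<le> 2 * h / (a\<^sup>2 * V) * (a\<^sup>2 * V * (2 / h * u0\<^sup>2 * (1 - h / 2) ^ k + 4 * a\<^sup>2 * V / h\<^sup>2))"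
      using m h V by (intro mult_left_mono) auto
    also have "\<dots> = 4 * u0\<^sup>2 * (1 - h / 2) ^ k + 8 * a\<^sup>2 * V / h"
    proof -
      have "2 * h / (a\<^sup>2 * V) * (a\<^sup>2 * V * z) = 2 * h * z" for z
        using a V by simp
      then have "2 * h / (a\<^sup>2 * V) * (a\<^sup>2 * V * (2 / h * u0\<^sup>2 * (1 - h / 2) ^ k + 4 * a\<^sup>2 * V / h\<^sup>2)) =
          2 * h * (2 / h * u0\<^sup>2 * (1 - h / 2) ^ k + 4 * a\<^sup>2 * V / h\<^sup>2)" .
      then show ?thesis
        using h(1) by (simp only: distrib_left) (simp add: power2_eq_square)
    qed
    also have "u0\<^sup>2 \<le> (1 + x\<^sub>0)\<^sup>2"
    proof (rule power2_le_iff_abs_le[THEN iffD2])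
      have "h * x\<^sub>0 \<le> 1 * x\<^sub>0" "0 \<le> h * x\<^sub>0"
        using h x0 by (intro mult_right_mono mult_nonneg_nonneg; simp)+
      then show "\<bar>u0\<bar> \<le> 1 + x\<^sub>0"
        unfolding u0_def by linarith
    qed (use x0 in simp)
    finally show "expectation (\<lambda>x. (R x)\<^sup>2) \<le> 4 * (1 + x\<^sub>0)\<^sup>2 * (1 - h / 2) ^ k + 8 * a\<^sup>2 * V / h"
      using h by (simp add: mult_right_mono)
  qed
  have L: "integrable M (\<lambda>x. (L x)\<^sup>2)"
    and EL: "expectation (\<lambda>x. (L x)\<^sup>2) \<le> 2 * (1 - h) ^ (k - p)"
  proof -
    note m = second_moment_weighted_sum[OF indep sq mean var, of "{..<p}" w]
    show "integrable M (\<lambda>x. (L x)\<^sup>2)"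
      using m by (simp add: L_def)
    have "expectation (\<lambda>x. (L x)\<^sup>2) = V * (\<Sum>j<p. (w j)\<^sup>2)"
      using m by (simp add: L_def)
    also have "\<dots> = 2 * h * (\<Sum>j<p. ((1 - h) ^ (k - 1 - j))\<^sup>2)"
      using h V by (simp add: w_def power_mult_distrib sum_distrib_left)
    also have "\<dots> \<le> 2 * h * (\<Sum>j<p. (1 - h) ^ (k - p) * (1 - h) ^ (p - 1 - j))"
    proof (intro mult_left_mono sum_mono)
      fix j assume "j \<in> {..<p}"
      then have "k - 1 - j = (k - p) + (p - 1 - j)"
        using pk by auto
      moreover have "((1 - h) ^ i)\<^sup>2 \<le> (1 - h) ^ i" for i
        using h by (simp add: power2_eq_square mult_left_le power_le_one)
      ultimately show "((1 - h) ^ (k - 1 - j))\<^sup>2 \<le> (1 - h) ^ (k - p) * (1 - h) ^ (p - 1 - j)"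
        by (metis power_add)
    qed (use h in simp)
    also have "\<dots> = 2 * (1 - h) ^ (k - p) * (1 - (1 - h) ^ p)"
    proof -
      have "(\<Sum>j<p. (1 - h) ^ (p - 1 - j)) = (\<Sum>i<p. (1 - h) ^ i)"
        using sum_power_rev_ivl[of "1 - h" p 0] by (simp only: lessThan_atLeast0 diff_zero)
      also have "\<dots> = (1 - (1 - h) ^ p) / h"
        using h by (simp add: sum_gp_strict)
      finally show ?thesis
        using h by (simp only: sum_distrib_left[symmetric]) simp
    qed
    also have "\<dots> \<le> 2 * (1 - h) ^ (k - p) * 1"
      using h by (intro mult_left_mono) auto
    finally show "expectation (\<lambda>x. (L x)\<^sup>2) \<le> 2 * (1 - h) ^ (k - p)"
      by simp
  qed
  have b: "b\<^sup>2 \<le> c\<^sup>2 / V * (1 + x\<^sub>0)\<^sup>2"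
  proof -
    have "((1 + (1 - h) ^ k * u0) / h - (\<Sum>j = 1..k - 1. exp (real j * - h)))\<^sup>2 \<le> (1 + x\<^sub>0)\<^sup>2"
      using centering_bound[OF h x0, of k] x0 unfolding u0_def
      by (intro power2_le_iff_abs_le[THEN iffD2]) auto
    moreover have "(c / sqrt V)\<^sup>2 = c\<^sup>2 / V"
      using V by (simp add: power_divide)
    ultimately show ?thesis
      unfolding b_def power_mult_distrib using V by (simp only: mult_left_mono divide_nonneg_pos zero_le_power2)
  qed
  have [measurable]: "R \<in> borel_measurable M" "L \<in> borel_measurable M"
    unfolding R_def L_def by measurable
  have dom: "(X x - U x)\<^sup>2 \<le> 3 * ((R x)\<^sup>2 + (L x)\<^sup>2 + b\<^sup>2)" for x
    unfolding decomp by (rule power2_sum3_le)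
  have int: "integrable M (\<lambda>x. 3 * ((R x)\<^sup>2 + (L x)\<^sup>2 + b\<^sup>2))"
    using R L by simp
  have 1: "integrable M (\<lambda>x. (X x - U x)\<^sup>2)"
  proof (rule Bochner_Integration.integrable_bound[OF int])
    show "(\<lambda>x. (X x - U x)\<^sup>2) \<in> borel_measurable M"
      unfolding decomp by measurable
    show "AE x in M. norm ((X x - U x)\<^sup>2) \<le> norm (3 * ((R x)\<^sup>2 + (L x)\<^sup>2 + b\<^sup>2))"
      using dom by simp
  qed
  have "expectation (\<lambda>x. (X x - U x)\<^sup>2) \<le> expectation (\<lambda>x. 3 * ((R x)\<^sup>2 + (L x)\<^sup>2 + b\<^sup>2))"
    using dom by (intro integral_mono 1 int)
  also have "\<dots> = 3 * (expectation (\<lambda>x. (R x)\<^sup>2) + expectation (\<lambda>x. (L x)\<^sup>2) + b\<^sup>2)"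
    using R L by (simp add: prob_space)
  finally show ?thesis
    using 1 ER EL b by simp
qed

end

theorem theorem2p1:
  fixes M :: "'a measure"
    and \<epsilon> :: "nat \<Rightarrow> 'a \<Rightarrow> real"
    and \<omega> \<sigma>\<^sub>0 \<delta> :: real
    and \<alpha> \<beta> \<gamma> :: "nat \<Rightarrow> real"
    and t :: "'n::{finite,linorder} \<Rightarrow> real"
  assumes "prob_space M"
    and "prob_space.indep_vars M (\<lambda>_. borel) \<epsilon> UNIV"
    and "\<And>i. distr M borel (\<epsilon> i) = distr M borel (\<epsilon> 0)"
    and "\<not> (\<exists>c. AE x in M. (\<epsilon> 0 x)\<^sup>2 = c)"
    and "\<omega> > 0"
    and "\<And>n. n \<ge> 1 \<Longrightarrow> \<alpha> n \<ge> 0"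
    and "\<And>n. n \<ge> 1 \<Longrightarrow> \<beta> n \<ge> 0"
    and "\<alpha> \<longlonglongrightarrow> 0"
    and "\<beta> \<longlonglongrightarrow> 1"
    and "\<And>n. n \<ge> 1 \<Longrightarrow> \<gamma> n = \<alpha> n + \<beta> n - 1"
    and "\<And>n. n \<ge> 1 \<Longrightarrow> \<gamma> n < 0"
    and "(\<integral>x. (\<epsilon> 0 x)\<^sup>2 \<partial>M) = 1"
    and "\<delta> > 0"
    and "integrable M (\<lambda>x. \<bar>\<epsilon> 0 x\<bar> powr (4 + \<delta>))"
    and "filterlim (\<lambda>n. real n * \<alpha> n) at_top sequentially"
    and "(\<lambda>n. sqrt (real n) * \<gamma> n) \<longlonglongrightarrow> 0"
    and "filterlim (\<lambda>n. real n * \<bar>\<gamma> n\<bar>) at_top sequentially"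
    and "(\<lambda>n. \<alpha> n * sqrt (real n) * ln (ln (real n))) \<longlonglongrightarrow> 0"
    and "(\<lambda>n. \<bar>\<gamma> n\<bar> powr (3 / 2) / \<alpha> n) \<longlonglongrightarrow> 0"
    and "strict_mono t"
    and "\<And>m. 0 < t m \<and> t m \<le> 1"
  shows "converges_weakly
    (\<lambda>n. distr M borel (\<lambda>x. \<chi> m.
       sqrt (2 * \<bar>\<gamma> n\<bar> ^ 3) / \<alpha> n * (1 / sqrt (\<integral>x. ((\<epsilon> 0 x)\<^sup>2 - 1)\<^sup>2 \<partial>M)) *
       ((garch_sigma \<omega> (\<alpha> n) (\<beta> n) \<sigma>\<^sub>0 (\<lambda>k. \<epsilon> k x) (nat \<lfloor>real n * t m\<rfloor>))\<^sup>2 / \<omega>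
        - (\<Sum>j = 1..nat \<lfloor>real n * t m\<rfloor> - 1. exp (real j * \<gamma> n)))))
    std_normal_vec"
proof -
  interpret prob_space M by fact
  have \<epsilon> [measurable]: "\<epsilon> i \<in> borel_measurable M" for i
    using assms(2) by (auto simp: indep_vars_def)
  define \<xi> where "\<xi> i x = (\<epsilon> i x)\<^sup>2 - 1" for i x
  define V where "V = (\<integral>x. ((\<epsilon> 0 x)\<^sup>2 - 1)\<^sup>2 \<partial>M)"
  define \<mu> where "\<mu> = distr M borel (\<xi> 0)"
  have \<xi> [measurable]: "\<xi> i \<in> borel_measurable M" for i
    unfolding \<xi>_def by measurable
  have indep: "indep_vars (\<lambda>_. borel) \<xi> UNIV"
    unfolding \<xi>_def by (rule indep_vars_compose2[OF assms(2)]) simp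
  have \<mu>: "distr M borel (\<xi> i) = \<mu>" for i
  proof -
    have D: "distr M borel (\<xi> i) = distr (distr M borel (\<epsilon> i)) borel (\<lambda>z. z\<^sup>2 - 1)" for i
      by (subst distr_distr) (auto simp: \<xi>_def[abs_def] o_def)
    show ?thesis
      unfolding \<mu>_def D[of i] D[of 0] assms(3)[of i] by (rule refl)
  qed
  have \<epsilon>2: "integrable M (\<lambda>x. (\<epsilon> 0 x)\<^sup>2)"
    using assms(12) not_integrable_integral_eq by fastforce
  have \<epsilon>4: "integrable M (\<lambda>x. (\<epsilon> 0 x) ^ 4)"
  proof (rule Bochner_Integration.integrable_bound)
    show "integrable M (\<lambda>x. 1 + \<bar>\<epsilon> 0 x\<bar> powr (4 + \<delta>))"
      using assms(14) by simp
    have "z ^ 4 \<le> 1 + \<bar>z\<bar> powr (4 + \<delta>)" for z :: real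
    proof (cases "\<bar>z\<bar> \<le> 1")
      case True
      then have "\<bar>z\<bar> ^ 4 \<le> 1" by (intro power_le_one) auto
      then show ?thesis by (simp add: power_even_abs add_increasing2)
    next
      case False
      then have "\<bar>z\<bar> powr 4 \<le> \<bar>z\<bar> powr (4 + \<delta>)"
        using assms(13) by (intro powr_mono) auto
      moreover have "\<bar>z\<bar> powr 4 = z ^ 4"
        using False by (simp add: powr_numeral)
      ultimately show ?thesis by simp
    qed
    then show "AE x in M. norm ((\<epsilon> 0 x) ^ 4) \<le> norm (1 + \<bar>\<epsilon> 0 x\<bar> powr (4 + \<delta>))"
      by (simp add: power_even_abs)
  qed simp
  have \<xi>2: "integrable M (\<lambda>x. (\<xi> 0 x)\<^sup>2)"
  proof -
    have "(\<lambda>x. (\<xi> 0 x)\<^sup>2) = (\<lambda>x. (\<epsilon> 0 x) ^ 4 - 2 * (\<epsilon> 0 x)\<^sup>2 + 1)"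
      by (auto simp: \<xi>_def power2_eq_square power4_eq_xxxx algebra_simps)
    then show ?thesis
      using \<epsilon>2 \<epsilon>4 by simp
  qed
  have \<mu>2: "integrable \<mu> (\<lambda>z. z\<^sup>2)" and \<mu>0: "(\<integral>z. z \<partial>\<mu>) = 0" and \<mu>V: "(\<integral>z. z\<^sup>2 \<partial>\<mu>) = V"
    using \<xi>2 \<epsilon>2 assms(12) by (simp_all add: \<mu>_def V_def integrable_distr_eq integral_distr) (simp_all add: \<xi>_def prob_space)
  interpret centered_noise M \<xi> V
  proof
    show "indep_vars (\<lambda>_. borel) \<xi> UNIV" by fact
    show "integrable M (\<lambda>x. (\<xi> i x)\<^sup>2)" "expectation (\<xi> i) = 0" "expectation (\<lambda>x. (\<xi> i x)\<^sup>2) = V" for i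
      using \<mu>2 \<mu>0 \<mu>V unfolding \<mu>[of i, symmetric]
      by (simp_all add: integrable_distr_eq integral_distr)
  qed
  have V: "V > 0"
  proof (rule ccontr)
    assume "\<not> V > 0"
    then have "(\<integral>x. (\<xi> 0 x)\<^sup>2 \<partial>M) = 0"
      using V_nonneg var[of 0] by simp
    then have "AE x in M. (\<xi> 0 x)\<^sup>2 = 0"
      using \<xi>2 by (subst (asm) integral_nonneg_eq_0_iff_AE) auto
    then have "AE x in M. (\<epsilon> 0 x)\<^sup>2 = 1"
      by eventually_elim (simp add: \<xi>_def)
    then show False
      using assms(4) by blast
  qed

  define h where "h n = - \<gamma> n" for n
  define x0 where "x0 = \<sigma>\<^sub>0\<^sup>2 / \<omega>"
  have x0: "x0 \<ge> 0" using assms(5) by (simp add: x0_def)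
  define s where "s m = Max (insert 0 (t ` {i. i < m}))" for m
  define k where "k n m = nat \<lfloor>real n * t m\<rfloor>" for n m
  define p where "p n m = nat \<lfloor>real n * s m\<rfloor>" for n m
  have s: "0 \<le> s m" "s m < t m" for m
    using assms(21)[of m] strict_monoD[OF assms(20)] by (auto simp: s_def)
  have st: "t i \<le> s m" if "i < m" for i m
    using that by (auto simp: s_def)
  have pk: "p n m \<le> k n m" for n m
    unfolding p_def k_def using s[of m] by (intro nat_mono floor_mono mult_left_mono) auto
  have kp: "k n i \<le> p n m" if "i < m" for n i m
    unfolding p_def k_def using st[OF that] by (intro nat_mono floor_mono mult_left_mono) auto

  have hpos: "\<forall>\<^sub>F n in sequentially. 0 < h n"
    using eventually_ge_at_top[of 1] by eventually_elim (use assms(11) in \<open>simp add: h_def\<close>)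
  have "(\<lambda>n. 1 - \<alpha> n - \<beta> n) \<longlonglongrightarrow> 1 - 0 - 1"
    by (intro tendsto_intros assms(8,9))
  then have "h \<longlonglongrightarrow> 1 - 0 - 1"
  proof (rule Lim_transform_eventually)
    show "\<forall>\<^sub>F n in sequentially. 1 - \<alpha> n - \<beta> n = h n"
      using eventually_ge_at_top[of 1] by eventually_elim (use assms(10) in \<open>simp add: h_def\<close>)
  qed
  then have h0: "h \<longlonglongrightarrow> 0"
    by simp
  have hlt: "\<forall>\<^sub>F n in sequentially. h n < 1"
    using h0 by (rule order_tendstoD) simp
  have apos: "\<forall>\<^sub>F n in sequentially. 0 < \<alpha> n"
  proof -
    have "\<forall>\<^sub>F n in sequentially. 0 < real n * \<alpha> n"
      using assms(15) by (simp add: filterlim_at_top_dense)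
    then show ?thesis
      by eventually_elim (simp add: zero_less_mult_iff)
  qed
  have nh: "filterlim (\<lambda>n. real n * h n) at_top sequentially"
    using assms(17)
  proof (rule filterlim_mono_eventually)
    show "\<forall>\<^sub>F n in sequentially. real n * \<bar>\<gamma> n\<bar> = real n * h n"
      using hpos by eventually_elim (simp add: h_def)
  qed auto
  have a2h: "(\<lambda>n. (\<alpha> n)\<^sup>2 / h n) \<longlonglongrightarrow> 0"
  proof -
    have "filterlim (\<lambda>n. ln (ln (real n))) at_top sequentially"
      by (intro filterlim_compose[OF ln_at_top] filterlim_real_sequentially)
    then have ll: "\<forall>\<^sub>F n in sequentially. 1 \<le> ln (ln (real n))"
      by (simp add: filterlim_at_top)
    have "(\<lambda>n. \<alpha> n * sqrt (real n)) \<longlonglongrightarrow> 0"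
    proof (rule Lim_null_comparison[OF _ tendsto_norm_zero[OF assms(18)]])
      show "\<forall>\<^sub>F n in sequentially. norm (\<alpha> n * sqrt (real n)) \<le> norm (\<alpha> n * sqrt (real n) * ln (ln (real n)))"
        using ll
      proof eventually_elim
        case (elim n)
        then show ?case
          using mult_left_mono[of 1 "\<bar>ln (ln (real n))\<bar>" "\<bar>\<alpha> n * sqrt (real n)\<bar>"]
          by (simp add: abs_mult)
      qed
    qed
    then have "(\<lambda>n. (\<alpha> n * sqrt (real n))\<^sup>2) \<longlonglongrightarrow> 0\<^sup>2"
      by (intro tendsto_intros)
    then have "(\<lambda>n. (\<alpha> n * sqrt (real n))\<^sup>2 / (real n * h n)) \<longlonglongrightarrow> 0"
      by (rule tendsto_divide_0) (rule filterlim_at_top_imp_at_infinity[OF nh])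
    then show ?thesis
      by (rule Lim_transform_eventually)
        (use eventually_gt_at_top[of 0] in \<open>eventually_elim, simp add: power_mult_distrib field_simps\<close>)
  qed
  have asmall: "\<forall>\<^sub>F n in sequentially. 4 * (\<alpha> n)\<^sup>2 * V \<le> h n"
  proof -
    have "\<forall>\<^sub>F n in sequentially. (\<alpha> n)\<^sup>2 / h n < 1 / (4 * V)"
      using a2h V by (intro order_tendstoD(2)) auto
    with hpos show ?thesis
      by eventually_elim (use V in \<open>simp add: field_simps\<close>)
  qed
  have c0: "(\<lambda>n. (sqrt (2 * h n ^ 3) / \<alpha> n)\<^sup>2) \<longlonglongrightarrow> 0"
  proof -
    have "(\<lambda>n. 2 * (\<bar>\<gamma> n\<bar> powr (3 / 2) / \<alpha> n)\<^sup>2) \<longlonglongrightarrow> 2 * 0\<^sup>2"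
      by (intro tendsto_intros assms(19))
    then have "(\<lambda>n. 2 * (\<bar>\<gamma> n\<bar> powr (3 / 2) / \<alpha> n)\<^sup>2) \<longlonglongrightarrow> 0"
      by simp
    then show ?thesis
    proof (rule Lim_transform_eventually)
      show "\<forall>\<^sub>F n in sequentially. 2 * (\<bar>\<gamma> n\<bar> powr (3 / 2) / \<alpha> n)\<^sup>2 = (sqrt (2 * h n ^ 3) / \<alpha> n)\<^sup>2"
        using hpos
      proof eventually_elim
        case (elim n)
        have "(h n powr (3 / 2))\<^sup>2 = h n powr 3"
          by (simp add: power2_eq_square powr_add[symmetric])
        also have "\<dots> = h n ^ 3"
          using elim by (simp add: powr_numeral)
        moreover have "\<bar>\<gamma> n\<bar> = h n"
          using elim by (simp add: h_def)
        ultimately show ?case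
          using elim by (simp add: power_divide)
      qed
    qed
  qed
  have decay: "(\<lambda>n. exp (- (h n * real (k n m - p n m)))) \<longlonglongrightarrow> 0" for m
  proof (rule filterlim_compose[OF exp_at_bot], subst filterlim_uminus_at_top[symmetric])
    have "filterlim (\<lambda>n. - h n + (t m - s m) * (real n * h n)) at_top sequentially"
      using s[of m] by (intro filterlim_tendsto_add_at_top[OF tendsto_minus[OF h0]]
          filterlim_tendsto_pos_mult_at_top[OF tendsto_const _ nh]) simp
    then show "filterlim (\<lambda>n. h n * real (k n m - p n m)) at_top sequentially"
    proof (rule filterlim_at_top_mono)
      show "\<forall>\<^sub>F n in sequentially. - h n + (t m - s m) * (real n * h n) \<le> h n * real (k n m - p n m)"
        using hpos
      proof eventually_elim
        case (elim n)
        have "real n * t m - real n * s m - 1 \<le> real (k n m - p n m)"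
          unfolding k_def p_def using s[of m] by (intro real_nat_floor_diff_ge mult_left_mono) auto
        then have "h n * (real n * t m - real n * s m - 1) \<le> h n * real (k n m - p n m)"
          using elim by (intro mult_left_mono) auto
        then show ?case
          by (simp add: algebra_simps)
      qed
    qed
  qed
  have gd: "(\<lambda>n. (1 - h n) ^ (k n m - p n m)) \<longlonglongrightarrow> 0" for m
  proof (rule Lim_null_comparison[OF _ decay])
    show "\<forall>\<^sub>F n in sequentially. norm ((1 - h n) ^ (k n m - p n m)) \<le> exp (- (h n * real (k n m - p n m)))"
      using hlt by eventually_elim (use one_minus_power_le_exp in \<open>simp add: abs_of_nonneg\<close>)
  qed
  have gk: "(\<lambda>n. (1 - h n / 2) ^ k n m) \<longlonglongrightarrow> 0" for m
  proof (rule Lim_null_comparison)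
    show "(\<lambda>n. sqrt (exp (- (h n * real (k n m - p n m))))) \<longlonglongrightarrow> 0"
      using tendsto_real_sqrt[OF decay] by simp
    show "\<forall>\<^sub>F n in sequentially. norm ((1 - h n / 2) ^ k n m) \<le> sqrt (exp (- (h n * real (k n m - p n m))))"
      using hlt hpos
    proof eventually_elim
      case (elim n)
      have "(1 - h n / 2) ^ k n m \<le> exp (- (h n / 2 * k n m))"
        using elim by (intro one_minus_power_le_exp) simp
      also have "\<dots> \<le> exp (- (h n * real (k n m - p n m)) / 2)"
        using elim by (simp add: mult_left_mono)
      also have "\<dots> = sqrt (exp (- (h n * real (k n m - p n m))))"
        by (rule real_sqrt_unique[symmetric]) (simp_all add: exp_double[symmetric] flip: exp_of_nat_mult)
      finally show ?case
        using elim by simp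
    qed
  qed

  define w where "w n m j = sqrt (2 * h n / V) * (1 - h n) ^ (k n m - 1 - j)" for n m j
  define U where "U n m x = (\<Sum>j\<in>{p n m..<k n m}. w n m j * \<xi> j x)" for n m x
  define X where "X n m x = sqrt (2 * \<bar>\<gamma> n\<bar> ^ 3) / \<alpha> n * (1 / sqrt V) *
       ((garch_sigma \<omega> (\<alpha> n) (\<beta> n) \<sigma>\<^sub>0 (\<lambda>k. \<epsilon> k x) (nat \<lfloor>real n * t m\<rfloor>))\<^sup>2 / \<omega>
        - (\<Sum>j = 1..nat \<lfloor>real n * t m\<rfloor> - 1. exp (real j * \<gamma> n)))" for n m x
  have U [measurable]: "U n m \<in> borel_measurable M" for n m
    unfolding U_def by measurable
  have [measurable]: "(\<lambda>x. garch_sigma \<omega> a b \<sigma>\<^sub>0 (\<lambda>k. \<epsilon> k x) i) \<in> borel_measurable M" for a b i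
    by (induction i) simp_all
  have X [measurable]: "X n m \<in> borel_measurable M" for n m
    unfolding X_def by measurable
  have w2: "\<forall>\<^sub>F n in sequentially. V * (\<Sum>j\<in>{p n m..<k n m}. (w n m j)\<^sup>2) =
      2 * (1 - ((1 - h n) ^ (k n m - p n m))\<^sup>2) / (2 - h n)" for m
    using hpos hlt by eventually_elim (use V in \<open>simp only: w_def, intro second_moment_block, auto\<close>)
  have wlim: "(\<lambda>n. V * (\<Sum>j\<in>{p n m..<k n m}. (w n m j)\<^sup>2)) \<longlonglongrightarrow> 1" for m
  proof -
    have "(\<lambda>n. 2 * (1 - ((1 - h n) ^ (k n m - p n m))\<^sup>2) / (2 - h n)) \<longlonglongrightarrow> 2 * (1 - 0\<^sup>2) / (2 - 0)"
      by (intro tendsto_intros gd h0) simp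
    then show ?thesis
      using w2[of m] by (simp add: tendsto_cong)
  qed
  have indU: "indep_vars (\<lambda>_. borel) (U n) UNIV" for n
  proof -
    have "disjoint_family (\<lambda>m. {p n m..<k n m})"
      unfolding disjoint_family_on_def
    proof (intro ballI impI)
      fix i m :: 'n assume "i \<noteq> m"
      then consider "i < m" | "m < i" by (auto simp: neq_iff)
      then have "k n i \<le> p n m \<or> k n m \<le> p n i"
        by cases (auto intro: kp)
      then show "{p n i..<k n i} \<inter> {p n m..<k n m} = {}"
        by auto
    qed
    then have "indep_vars (\<lambda>m. PiM {p n m..<k n m} (\<lambda>_. borel)) (\<lambda>m x. restrict (\<lambda>j. \<xi> j x) {p n m..<k n m}) UNIV"
      by (intro indep_vars_restrict[OF indep]) auto
    then have "indep_vars (\<lambda>_. borel) (\<lambda>m x. \<Sum>j\<in>{p n m..<k n m}. w n m j * restrict (\<lambda>j. \<xi> j x) {p n m..<k n m} j) UNIV"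
      by (rule indep_vars_compose2) measurable
    then show ?thesis
      unfolding U_def by simp
  qed
  have "weak_conv_m (\<lambda>n. distr M borel (U n m)) std_normal_distribution" for m
    unfolding U_def
  proof (rule weak_conv_m_weighted_sum[OF indep \<mu> \<mu>2 \<mu>0 \<mu>V wlim])
    show "\<forall>\<^sub>F n in sequentially. \<forall>j\<in>{p n m..<k n m}. \<bar>w n m j\<bar> \<le> sqrt (2 * h n / V)"
      using hpos hlt
    proof eventually_elim
      case (elim n)
      then have "sqrt (2 * h n / V) * (1 - h n) ^ i \<le> sqrt (2 * h n / V)" for i
        using V by (intro mult_left_le power_le_one) auto
      then show ?case
        using elim V by (simp add: w_def abs_mult)
    qed
    have "(\<lambda>n. sqrt (2 * h n / V)) \<longlonglongrightarrow> sqrt (2 * 0 / V)"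
      by (intro tendsto_intros h0) (use V in auto)
    then show "(\<lambda>n. sqrt (2 * h n / V)) \<longlonglongrightarrow> 0"
      by simp
  qed
  then have "converges_weakly (\<lambda>n. distr (PiM UNIV (\<lambda>m. distr M borel (U n m))) borel vec_lambda) std_normal_vec"
    unfolding std_normal_vec_def
    by (intro converges_weakly_PiM real_dist_normal_dist real_distribution_distr U)
  then have conv: "converges_weakly (\<lambda>n. distr M borel (\<lambda>x. \<chi> m. U n m x)) std_normal_vec"
    by (simp add: distr_vec_indep[OF indU])
  define b where "b n m = 3 * (4 * (1 + x0)\<^sup>2 * (1 - h n / 2) ^ k n m + 8 * (\<alpha> n)\<^sup>2 * V / h n +
      2 * (1 - h n) ^ (k n m - p n m) + (sqrt (2 * h n ^ 3) / \<alpha> n)\<^sup>2 / V * (1 + x0)\<^sup>2)" for n m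
  have "converges_weakly (\<lambda>n. distr M borel (\<lambda>x. \<chi> m. X n m x)) std_normal_vec"
  proof (rule converges_weakly_perturb_vec[OF X U conv])
    show "\<forall>\<^sub>F n in sequentially. integrable M (\<lambda>x. (U n m x)\<^sup>2) \<and> expectation (\<lambda>x. (U n m x)\<^sup>2) \<le> 2" for m
    proof -
      have "\<forall>\<^sub>F n in sequentially. V * (\<Sum>j\<in>{p n m..<k n m}. (w n m j)\<^sup>2) < 2"
        using wlim by (rule order_tendstoD) simp
      then show ?thesis
        by eventually_elim (use second_moment_weighted_sum[OF indep sq mean var] in \<open>simp add: U_def\<close>)
    qed
    show "\<forall>\<^sub>F n in sequentially. integrable M (\<lambda>x. (X n m x - U n m x)\<^sup>2) \<and>
        expectation (\<lambda>x. (X n m x - U n m x)\<^sup>2) \<le> b n m" for m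
      using hpos hlt apos asmall eventually_ge_at_top[of 1]
    proof eventually_elim
      case (elim n)
      have \<gamma>: "\<bar>\<gamma> n\<bar> = h n" "\<gamma> n = - h n"
        using elim by (auto simp: h_def)
      have "h n = 1 - \<alpha> n - \<beta> n"
        using assms(10)[of n] elim by (simp add: h_def)
      then have g: "(garch_sigma \<omega> (\<alpha> n) (\<beta> n) \<sigma>\<^sub>0 (\<lambda>k. \<epsilon> k x) i)\<^sup>2 / \<omega> =
          (1 + vol_dev (h n) (\<alpha> n) (h n * x0 - 1) (\<lambda>j. \<xi> j x) i) / h n" for x i
        using elim assms(5) assms(7)[of n] unfolding x0_def \<xi>_def
        by (subst garch_sigma_eq_vol_dev[where h = "h n"]) auto
      show ?case
        unfolding X_def U_def w_def b_def \<gamma>(1) unfolding \<gamma>(2) g k_def[symmetric]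
        using elim by (intro component_error V x0 pk) auto
    qed
    show "(\<lambda>n. b n m) \<longlonglongrightarrow> 0" for m
    proof -
      have "(\<lambda>n. 3 * (4 * (1 + x0)\<^sup>2 * (1 - h n / 2) ^ k n m + 8 * V * ((\<alpha> n)\<^sup>2 / h n) +
          2 * (1 - h n) ^ (k n m - p n m) + (sqrt (2 * h n ^ 3) / \<alpha> n)\<^sup>2 / V * (1 + x0)\<^sup>2)) \<longlonglongrightarrow>
          3 * (4 * (1 + x0)\<^sup>2 * 0 + 8 * V * 0 + 2 * 0 + 0 / V * (1 + x0)\<^sup>2)"
        by (intro tendsto_intros gk a2h gd c0) (use V in auto)
      then show ?thesis
        unfolding b_def by (simp add: mult_ac)
    qed
  qed
  then show ?thesis
    unfolding X_def V_def .
qed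

end
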